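(* Let $\mu_1>0$ and $-\mu_1/5^{5/3}<\mu_2<0$, set $\mu=\mu_1+\mu_2>0$, and consider the homogeneous isotropic incompressible Mooney-Rivlin unit cube with coefficients $\mu_1,\mu_2$ under equitriaxial dead load $\tau$. Along the family of deformations with two equal stretches, $(\lambda_1,\lambda_2,\lambda_3)=(\lambda,\lambda^{-1/2},\lambda^{-1/2})$, $\lambda\neq 1$, $\lambda>-\mu_2/\mu_1$ (the last restriction expressing the Baker-Ericksen inequalities), the dead load in equilibrium is $\tau(\lambda)=\left(\mu_1+\frac{\mu_2}{\lambda}\right)\left(\lambda+\frac{1}{\sqrt{\lambda}}\right)$. Then: (a) The function $\lambda\mapsto\tau(\lambda)$ on $(-\mu_2/\mu_1,+\infty)$ has a local maximum, with value $\tau^{*}>0$, attained at some $\lambda^{*}$ satisfying $-\frac{\mu_2}{\mu_1}<\lambda^{*}<-\frac{5\mu_2}{\mu_1}<\frac{1}{5^{2/3}}$, and a local minimum, with value $\tau_{*}>0$, attained at some $\lambda_{*}$ satisfying $-\frac{5\mu_2}{\mu_1}<\lambda_{*}<1$. (b) For every dead load $\tau$ with $\tau_{*}<\tau<\tau^{*}$ there exists a neutrally stable plate-like equilibrium. (c) If $\tau^{*}>2\mu$, then neutrally stable plate-like deformations are obtained after the reference state has become unstable, i.e. for dead loads $2\mu<\tau<\tau^{*}$ the reference state is unstable and a neutrally stable plate-like equilibrium exists. The condition $\tau^{*}>2\mu$ holds if $$\inf_{0<\lambda<1}\frac{\lambda^{5/2}-2\lambda^{3/2}+\lambda}{\lambda^{3/2}-1}<\frac{\mu_2}{\mu_1}<0,$$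 where the infimum is approximately $-0.045$.
   Context: Setting. The body occupies $V=(0,1)^3$ in the reference configuration. The Mooney-Rivlin strain-energy function is $$\mathcal W(\lambda_1,\lambda_2,\lambda_3)=\frac{\mu_1}{2}(\lambda_1^2+\lambda_2^2+\lambda_3^2-3)+\frac{\mu_2}{2}(\lambda_1^{-2}+\lambda_2^{-2}+\lambda_3^{-2}-3),$$ where $\lambda_i>0$ are the principal stretches (singular values) of the deformation gradient $\mathbf F$; write $W(\mathbf F)=\mathcal W(\lambda_1,\lambda_2,\lambda_3)$. The material is incompressible: $\det\mathbf F=1$. The total free energy of a deformation $\mathbf x:V\to\mathbb R^3$ with $\nabla\mathbf x=\mathbf F$ under equitriaxial dead load $\tau$ is $E(\mathbf x)=\int_V [W(\mathbf F)-\tau\,\mathrm{tr}(\mathbf F)]\,dV$. Homogeneous triaxial equilibria. A homogeneous triaxial stretch has $\nabla\mathbf x=\mathrm{diag}(\lambda_1,\lambda_2,\lambda_3)$ with constants $\lambda_i>0$, $\lambda_1\lambda_2\lambda_3=1$. It is an equilibrium under dead load $\tau$ if there is a constant $p\in\mathbb R$ with $-\frac{p}{\lambda_i}+\mu_1\lambda_i-\frac{\mu_2}{\lambda_i^3}=\tau$ for $i=1,2,3$. The reference (trivial) state is $\lambda_1=\lambda_2=\lambda_3=1$. Up to permutation of the axes, a non-trivial state with two equal stretches is $(\lambda,\lambda^{-1/2},\lambda^{-1/2})$ with $\lambda\ne1$; it is called plate-like if $\lambda<1$ and rod-like if $\lambda>1$. Baker-Ericksen inequalities (standing assumption on the admissible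 deformations): $(T_i-T_j)(\lambda_i-\lambda_j)>0$ whenever $\lambda_i\ne\lambda_j$, where $T_i=-p+\mu_1\lambda_i^2-\mu_2\lambda_i^{-2}$ are the principal Cauchy stresses. Equivalently $\mu_1+\mu_2\lambda_k^2>0$ whenever $\{i,j,k\}=\{1,2,3\}$ and $\lambda_i\ne\lambda_j$. Stability. A deformation $\mathbf x$ with $\det\nabla\mathbf x=1$ is neutrally stable if it is a (not necessarily strict) local minimum of the total free energy: $E(\mathbf x)\le E(\mathbf y)$ for all continuous, piecewise differentiable deformations $\mathbf y$ of $V$ with $\det\nabla\mathbf y=1$ and with $\sup_V|\nabla\mathbf y-\nabla\mathbf x|$ sufficiently small. It is stable if the inequality is strict (for $\nabla\mathbf y\not\equiv\nabla\mathbf x$), and unstable if it is not a local minimum in the non-strict sense. *)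

theory Defs
  imports "HOL-Analysis.Analysis"
begin

section \<open>Kinematics\<close>

definition unit_cube :: "(real^3) set" where
  "unit_cube = {X. \<forall>i. 0 < X $ i \<and> X $ i < 1}"

definition diag_matrix :: "real^3 \<Rightarrow> real^3^3" where
  "diag_matrix l = (\<chi> i j. if i = j then l $ i else 0)"

text \<open>Only meaningful at points where \<open>x\<close> is differentiable.\<close>
definition def_grad :: "(real^3 \<Rightarrow> real^3) \<Rightarrow> real^3 \<Rightarrow> real^3^3" where
  "def_grad x X = matrix (frechet_derivative x (at X))"

text \<open>The entries of \<open>l\<close> are the singular values of \<open>F\<close>, listed with multiplicity in some
  order (singular value decomposition).\<close>
definition singular_values :: "real^3^3 \<Rightarrow> real^3 \<Rightarrow> bool" where
  "singular_values F l \<longleftrightarrow> (\<forall>i. 0 \<le> l $ i) \<and>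
     (\<exists>P Q. orthogonal_matrix P \<and> orthogonal_matrix Q \<and>
            F = P ** diag_matrix l ** transpose Q)"

text \<open>Continuous on the cube, and differentiable (one-sidedly at interfaces) on each of finitely
  many relatively closed pieces with negligible boundaries; hence differentiable almost
  everywhere on the cube.\<close>
definition piecewise_differentiable :: "(real^3 \<Rightarrow> real^3) \<Rightarrow> bool" where
  "piecewise_differentiable y \<longleftrightarrow> continuous_on unit_cube y \<and>
     (\<exists>\<K>. finite \<K> \<and> \<Union>\<K> = unit_cube \<and>
        (\<forall>K\<in>\<K>. closedin (top_of_set unit_cube) K \<and> negligible (frontier K) \<and>
                y differentiable_on K))"

text \<open>The incompressibility constraint is imposed wherever the gradient exists.\<close>
definition isochoric_deformation :: "(real^3 \<Rightarrow> real^3) \<Rightarrow> bool" where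
  "isochoric_deformation y \<longleftrightarrow> piecewise_differentiable y \<and>
     (\<forall>X\<in>unit_cube. y differentiable (at X) \<longrightarrow> det (def_grad y X) = 1)"

definition homogeneous_stretch :: "real^3 \<Rightarrow> real^3 \<Rightarrow> real^3" where
  "homogeneous_stretch l X = diag_matrix l *v X"

definition two_equal_stretches :: "real \<Rightarrow> real^3" where
  "two_equal_stretches s = vector [s, 1 / sqrt s, 1 / sqrt s]"

definition reference_stretches :: "real^3" where
  "reference_stretches = vector [1, 1, 1]"


section \<open>Mooney-Rivlin energy\<close>

definition mooney_rivlin :: "real \<Rightarrow> real \<Rightarrow> real^3 \<Rightarrow> real" where
  "mooney_rivlin \<mu>1 \<mu>2 l =
     \<mu>1 / 2 * ((l $ 1)\<^sup>2 + (l $ 2)\<^sup>2 + (l $ 3)\<^sup>2 - 3) +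
     \<mu>2 / 2 * (1 / (l $ 1)\<^sup>2 + 1 / (l $ 2)\<^sup>2 + 1 / (l $ 3)\<^sup>2 - 3)"

text \<open>The singular values of a matrix are unique up to order and \<open>mooney_rivlin\<close> is symmetric
  in the stretches, so the choice of the ordering is immaterial.\<close>
definition strain_energy :: "real \<Rightarrow> real \<Rightarrow> real^3^3 \<Rightarrow> real" where
  "strain_energy \<mu>1 \<mu>2 F = mooney_rivlin \<mu>1 \<mu>2 (SOME l. singular_values F l)"

definition total_energy :: "real \<Rightarrow> real \<Rightarrow> real \<Rightarrow> (real^3 \<Rightarrow> real^3) \<Rightarrow> real" where
  "total_energy \<mu>1 \<mu>2 \<tau> x =
     (LINT X:unit_cube|lebesgue.
        strain_energy \<mu>1 \<mu>2 (def_grad x X) - \<tau> * trace (def_grad x X))"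


section \<open>Homogeneous triaxial equilibria\<close>

definition triaxial_equilibrium :: "real \<Rightarrow> real \<Rightarrow> real \<Rightarrow> real^3 \<Rightarrow> bool" where
  "triaxial_equilibrium \<mu>1 \<mu>2 \<tau> l \<longleftrightarrow>
     (\<forall>i. 0 < l $ i) \<and> l $ 1 * l $ 2 * l $ 3 = 1 \<and>
     (\<exists>p. \<forall>i. - p / l $ i + \<mu>1 * l $ i - \<mu>2 / (l $ i) ^ 3 = \<tau>)"

definition cauchy_stress :: "real \<Rightarrow> real \<Rightarrow> real \<Rightarrow> real \<Rightarrow> real" where
  "cauchy_stress \<mu>1 \<mu>2 p s = - p + \<mu>1 * s\<^sup>2 - \<mu>2 / s\<^sup>2"

text \<open>The pressure \<open>p\<close> cancels in the stress differences.\<close>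
definition baker_ericksen :: "real \<Rightarrow> real \<Rightarrow> real^3 \<Rightarrow> bool" where
  "baker_ericksen \<mu>1 \<mu>2 l \<longleftrightarrow>
     (\<forall>p i j. l $ i \<noteq> l $ j \<longrightarrow>
        (cauchy_stress \<mu>1 \<mu>2 p (l $ i) - cauchy_stress \<mu>1 \<mu>2 p (l $ j)) * (l $ i - l $ j) > 0)"

definition plate_like_equilibrium :: "real \<Rightarrow> real \<Rightarrow> real \<Rightarrow> real \<Rightarrow> bool" where
  "plate_like_equilibrium \<mu>1 \<mu>2 \<tau> s \<longleftrightarrow>
     0 < s \<and> s < 1 \<and> triaxial_equilibrium \<mu>1 \<mu>2 \<tau> (two_equal_stretches s) \<and>
     baker_ericksen \<mu>1 \<mu>2 (two_equal_stretches s)"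

definition dead_load :: "real \<Rightarrow> real \<Rightarrow> real \<Rightarrow> real" where
  "dead_load \<mu>1 \<mu>2 s = (\<mu>1 + \<mu>2 / s) * (s + 1 / sqrt s)"


section \<open>Stability\<close>

text \<open>The norm on matrices is the Frobenius norm; the bound on the gradients is imposed wherever
  both of them exist, and amounts to a bound on their supremum.\<close>
definition neutrally_stable :: "real \<Rightarrow> real \<Rightarrow> real \<Rightarrow> (real^3 \<Rightarrow> real^3) \<Rightarrow> bool" where
  "neutrally_stable \<mu>1 \<mu>2 \<tau> x \<longleftrightarrow> isochoric_deformation x \<and>
     (\<exists>\<delta>>0. \<forall>y. isochoric_deformation y \<and>
        (\<forall>X\<in>unit_cube. x differentiable (at X) \<and> y differentiable (at X) \<longrightarrow>
           norm (def_grad y X - def_grad x X) \<le> \<delta>) \<longrightarrow>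
        total_energy \<mu>1 \<mu>2 \<tau> x \<le> total_energy \<mu>1 \<mu>2 \<tau> y)"

definition unstable :: "real \<Rightarrow> real \<Rightarrow> real \<Rightarrow> (real^3 \<Rightarrow> real^3) \<Rightarrow> bool" where
  "unstable \<mu>1 \<mu>2 \<tau> x \<longleftrightarrow> isochoric_deformation x \<and> \<not> neutrally_stable \<mu>1 \<mu>2 \<tau> x"


section \<open>Local extrema of real functions\<close>

definition local_max_on :: "(real \<Rightarrow> real) \<Rightarrow> real set \<Rightarrow> real \<Rightarrow> bool" where
  "local_max_on f S a \<longleftrightarrow> a \<in> S \<and> (\<forall>\<^sub>F s in at a within S. f s \<le> f a)"

definition local_min_on :: "(real \<Rightarrow> real) \<Rightarrow> real set \<Rightarrow> real \<Rightarrow> bool" where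
  "local_min_on f S a \<longleftrightarrow> a \<in> S \<and> (\<forall>\<^sub>F s in at a within S. f a \<le> f s)"

end

theory Submission
  imports Defs
begin

text \<open>The obstacle is the energy of a competitor: it is evaluated at an arbitrary choice of
  singular values, in an unknown order, while nearness is known only for the gradient itself.
  Matching all three stretches with those of the plate would call for perturbation theory and a
  treatment of the double stretch. The comparison at fixed \<open>a\<close> avoids this, since it
  holds for all positive \<open>b\<close> and \<open>c\<close> with \<open>a * b * c = 1\<close>,
  however far from the plate; hence one stretch of each gradient near the plate stretch is enough,
  whichever position it has. Invariants of \<open>transpose F ** F\<close> make the energy
  independent of the choice of stretches and continuous in the gradient, which yields integrability.
  The constant \<open>5 powr (5/3)\<close> marks the existence of a descending branch: with
  \<open>k = - \<mu>2 / \<mu>1\<close> the slope polynomial has its least value for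
  \<open>u \<ge> 0\<close> at \<open>u ^ 3 = 1 / 5\<close>, and this value is negative exactly when
  \<open>k < 1 / 5 powr (5/3)\<close>. The separating stretch \<open>5 * k\<close> is a point where
  the polynomial factors and its sign is visible.\<close>

text \<open>For a dead load \<open>\<tau> \<ge> 0\<close> the term \<open>- \<tau> * trace F\<close> is smallest when \<open>F\<close> is its own right
  stretch, so neutral stability of a homogeneous state against arbitrary piecewise differentiable
  competitors reduces to a local minimum of the energy density over stretches \<open>(a, b, c)\<close> with
  \<open>a * b * c = 1\<close>. For fixed \<open>a\<close> near a plate stretch, the density is smallest at \<open>b = c\<close>. Along
  \<open>b = c\<close> its derivative is \<open>(\<tau>(a) - \<tau>) * (1 - a powr (-3/2))\<close>, so for \<open>a < 1\<close> the minima lie exactly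
  on the descending branch of the load curve, between its local maximum and its local minimum.
  The reference state loses stability for \<open>\<tau> > 2 * \<mu>\<close> to the stretches \<open>(1, r, 1 / r)\<close>.\<close>

section \<open>Singular value decomposition\<close>

lemma trace_3: "trace (A::real^3^3) = A$1$1 + A$2$2 + A$3$3"
  by (simp add: trace_def sum_3)

lemma compact_orthogonal_matrices: "compact {P :: real^3^3. orthogonal_matrix P}"
proof -
  have "norm P \<le> sqrt 3" if "orthogonal_matrix P" for P :: "real^3^3"
  proof -
    have "norm (P$i) = 1" for i
      using that by (simp add: orthogonal_matrix_orthonormal_rows row_def)
    then show ?thesis by (simp add: norm_vec_def[of P] L2_set_def)
  qed
  then have "bounded {P :: real^3^3. orthogonal_matrix P}"
    unfolding bounded_iff by auto
  moreover have "closed {P :: real^3^3. orthogonal_matrix P}"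
  proof -
    have "{P :: real^3^3. orthogonal_matrix P} =
        (\<Inter>i. \<Inter>j. {P. (\<Sum>k\<in>UNIV. P$k$i * P$k$j) = mat 1 $ i $ j})"
      unfolding orthogonal_matrix
      by (auto simp: vec_eq_iff matrix_matrix_mult_def transpose_def)
    moreover have "closed {P :: real^3^3. (\<Sum>k\<in>UNIV. P$k$i * P$k$j) = mat 1 $ i $ j}" for i j
      by (intro closed_Collect_eq continuous_intros)
    ultimately show ?thesis
      by (simp only:) (intro closed_INT ballI)
  qed
  ultimately show ?thesis
    by (simp add: compact_eq_bounded_closed)
qed

text \<open>Givens rotation in the plane of the axes \<open>i\<close> and \<open>j\<close>: for
  \<open>i \<noteq> j\<close> a smooth curve of orthogonal matrices through the identity, used as
  test variation of a maximiser.\<close>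

definition plane_rotation :: "3 \<Rightarrow> 3 \<Rightarrow> real \<Rightarrow> real^3^3" where
  "plane_rotation i j t = (\<chi> a b.
     if a = b then (if a = i \<or> a = j then cos t else 1)
     else if a = j \<and> b = i then sin t else if a = i \<and> b = j then - sin t else 0)"

lemma orthogonal_plane_rotation:
  assumes "i \<noteq> j" shows "orthogonal_matrix (plane_rotation i j t)"
proof -
  have *: "cos t * cos t + sin t * sin t = 1" "sin t * sin t + cos t * cos t = 1"
    using sin_cos_squared_add3[of t] by (simp_all add: add.commute)
  show ?thesis
    using assms exhaust_3[of i] exhaust_3[of j]
    by (elim disjE) (simp_all add: orthogonal_matrix vec_eq_iff matrix_matrix_mult_def
        transpose_def plane_rotation_def sum_3 forall_3 mat_def *)
qed

lemma trace_mult_plane_rotation: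
  assumes "i \<noteq> j"
  shows "trace (M ** plane_rotation i j t) =
     trace M + (cos t - 1) * (M$i$i + M$j$j) + sin t * (M$i$j - M$j$i)"
  using assms exhaust_3[of i] exhaust_3[of j]
  by (elim disjE) (simp_all add: trace_3 matrix_matrix_mult_def plane_rotation_def sum_3 algebra_simps)

text \<open>Along plane rotations the trace has derivative \<open>M$i$j - M$j$i\<close> at angle 0,
  which must vanish at a maximum. Negating column \<open>i\<close> changes the trace by
  \<open>- 2 * M$i$i\<close>, which must not be positive.\<close>

lemma symmetric_if_trace_maximal:
  fixes M :: "real^3^3"
  assumes max: "\<And>R. orthogonal_matrix R \<Longrightarrow> trace (M ** R) \<le> trace M"
  shows "M$i$j = M$j$i" and "0 \<le> M$i$i"
proof -
  show "M$i$j = M$j$i"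
  proof (cases "i = j")
    case False
    let ?g = "\<lambda>t. trace M + (cos t - 1) * (M$i$i + M$j$j) + sin t * (M$i$j - M$j$i)"
    have "(?g has_real_derivative M$i$j - M$j$i) (at 0)"
      by (auto intro!: derivative_eq_intros)
    moreover have "?g t \<le> ?g 0" for t
      using max[OF orthogonal_plane_rotation[OF False, of t]]
      by (simp add: trace_mult_plane_rotation[OF False])
    ultimately have "M$i$j - M$j$i = 0"
      by (intro DERIV_local_max[of ?g _ 0 1]) auto
    then show ?thesis by simp
  qed simp
  let ?R = "(\<chi> a b. if a = b then (if a = i then -1 else 1) else 0) :: real^3^3"
  have "orthogonal_matrix ?R"
    using exhaust_3[of i]
    by (auto simp: orthogonal_matrix vec_eq_iff matrix_matrix_mult_def transpose_def
        sum_3 forall_3 mat_def)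
  moreover have "trace (M ** ?R) = trace M - 2 * M$i$i"
    using exhaust_3[of i]
    by (auto simp: trace_3 matrix_matrix_mult_def sum_3)
  ultimately show "0 \<le> M$i$i"
    using max[of ?R] by simp
qed

text \<open>Maximise \<open>trace (D ** A)\<close> with \<open>D = diag (3, 2, 1)\<close> and \<open>A = transpose P ** F ** Q\<close> over
  orthogonal \<open>P\<close> and \<open>Q\<close>. By stationarity \<open>D ** A\<close> and \<open>A ** D\<close> are symmetric, and as the entries of
  \<open>D\<close> have distinct squares, \<open>A\<close> is diagonal.\<close>

lemma singular_values_exist: "\<exists>l. singular_values F l"
proof -
  define d :: "real^3" where "d = vector [3, 2, 1]"
  let ?D = "diag_matrix d"
  let ?O = "{P :: real^3^3. orthogonal_matrix P}"
  let ?f = "\<lambda>(P, Q). trace (?D ** transpose P ** F ** Q)"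
  have "\<exists>z\<in>?O \<times> ?O. \<forall>w\<in>?O \<times> ?O. ?f w \<le> ?f z"
  proof (rule continuous_attains_sup)
    show "compact (?O \<times> ?O)"
      by (intro compact_Times compact_orthogonal_matrices)
    show "?O \<times> ?O \<noteq> {}"
      using orthogonal_matrix_id by blast
    show "continuous_on (?O \<times> ?O) ?f"
      unfolding case_prod_beta trace_def matrix_matrix_mult_def transpose_def
      by (simp, intro continuous_intros)
  qed
  then obtain P Q where P: "orthogonal_matrix P" and Q: "orthogonal_matrix Q"
    and max: "\<And>P' Q'. orthogonal_matrix P' \<Longrightarrow> orthogonal_matrix Q' \<Longrightarrow>
       trace (?D ** transpose P' ** F ** Q') \<le> trace (?D ** transpose P ** F ** Q)"
    by auto
  define A where "A = transpose P ** F ** Q"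
  have "trace (?D ** A ** R) \<le> trace (?D ** A)" if "orthogonal_matrix R" for R
    using max[OF P orthogonal_matrix_mul[OF Q that]]
    by (simp add: A_def matrix_mul_assoc)
  note 1 = symmetric_if_trace_maximal[OF this]
  have "trace (A ** ?D ** R) \<le> trace (A ** ?D)" if "orthogonal_matrix R" for R
  proof -
    \<comment> \<open>Varying \<open>P\<close> instead of \<open>Q\<close> places \<open>R\<close>
      between \<open>?D\<close> and \<open>A\<close>; the cyclic invariance of the trace moves it to
      the right of \<open>A ** ?D\<close>.\<close>
    have "orthogonal_matrix (P ** transpose R)"
      using P that by (simp add: orthogonal_matrix_mul)
    from max[OF this Q] have "trace (?D ** R ** A) \<le> trace (?D ** A)"
      by (simp add: A_def matrix_mul_assoc matrix_transpose_mul)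
    then show ?thesis
      by (metis trace_mul_sym matrix_mul_assoc)
  qed
  note 2 = symmetric_if_trace_maximal[OF this]
  have d: "d$1 = 3" "d$2 = 2" "d$3 = 1" by (simp_all add: d_def)
  have DA: "(?D ** A)$i$j = d$i * A$i$j" and AD: "(A ** ?D)$i$j = A$i$j * d$j" for i j
    by (simp_all add: matrix_matrix_mult_def diag_matrix_def if_distrib[of "\<lambda>x. x * _"]
        if_distrib[of "\<lambda>x. _ * x"] cong: if_cong)
  have d_inj: "d$i \<noteq> d$j" and d_pos: "0 < d$i" "0 < d$j" if "i \<noteq> j" for i j
    using that exhaust_3[of i] exhaust_3[of j] d by auto
  have off: "A$i$j = 0" if "i \<noteq> j" for i j
  proof -
    have "d$i * A$i$j = d$j * A$j$i" "A$i$j * d$j = A$j$i * d$i"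
      using 1(1)[of i j] 2(1)[of i j] by (simp_all add: DA AD)
    then have "(d$i * d$i - d$j * d$j) * A$i$j = 0"
      by algebra
    moreover have "d$i * d$i - d$j * d$j \<noteq> 0"
      using d_inj[OF that] d_pos[OF that] by (simp add: square_eq_iff)
    ultimately show ?thesis by simp
  qed
  define l where "l = (\<chi> i. A$i$i)"
  have "0 \<le> l$i" for i
    using 1(2)[of i] d exhaust_3[of i] by (auto simp: DA l_def zero_le_mult_iff)
  moreover have "A = diag_matrix l"
    by (auto simp: vec_eq_iff diag_matrix_def l_def off)
  moreover have "F = P ** A ** transpose Q"
    using P Q unfolding A_def orthogonal_matrix_def
    by (metis matrix_mul_assoc matrix_mul_lid matrix_mul_rid)
  ultimately show ?thesis
    using P Q unfolding singular_values_def by auto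
qed

section \<open>The load curve\<close>

text \<open>The sign of the slope of the load curve at \<open>s = u\<^sup>2\<close> is that of
  \<open>u ^ 5 - u\<^sup>2 / 2 + 3 * k / 2\<close> with \<open>k = - \<mu>2 / \<mu>1\<close>, which decreases up to
  \<open>u ^ 3 = 1 / 5\<close> and increases afterwards.\<close>

lemma slope_polynomial_signs:
  fixes k :: real
  assumes k: "0 < k" "k < 1 / 5 powr (5/3)"
  defines "h \<equiv> \<lambda>u. u ^ 5 - u\<^sup>2 / 2 + 3 * k / 2"
  obtains u1 u2 where "sqrt k < u1" "u1 < sqrt (5 * k)" "sqrt (5 * k) < u2" "u2 < 1"
    and "\<And>u. 0 \<le> u \<Longrightarrow> u < u1 \<Longrightarrow> 0 < h u"
    and "\<And>u. u1 < u \<Longrightarrow> u < u2 \<Longrightarrow> h u < 0"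
    and "\<And>u. u2 < u \<Longrightarrow> 0 < h u"
proof -
  \<comment> \<open>The positive critical point of \<open>h\<close>. Since
    \<open>h c = 3 / 10 * (5 * k - c\<^sup>2)\<close> and
    \<open>c\<^sup>2 = 5 / 5 powr (5/3)\<close>, the upper bound on \<open>k\<close> says exactly
    that \<open>h c < 0\<close>.\<close>
  define c :: real where "c = 5 powr (-1/3)"
  have c3: "c ^ 3 = 1 / 5"
    unfolding c_def by (subst powr_power) (auto simp: powr_minus divide_simps)
  have c2: "c\<^sup>2 = 5 / 5 powr (5/3)"
  proof -
    have "c\<^sup>2 = 5 powr (1 - 5/3)"
      unfolding c_def by (subst powr_power) auto
    then show ?thesis by (simp only: powr_diff) simp
  qed
  have c0: "0 < c" by (simp add: c_def)
  have c1: "c < 1"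
  proof (rule ccontr)
    assume "\<not> c < 1"
    then have "1 \<le> c ^ 3" by (intro one_le_power) auto
    then show False using c3 by simp
  qed
  have h': "(h has_real_derivative u * (5 * u ^ 3 - 1)) (at u)" for u
    unfolding h_def by (auto intro!: derivative_eq_intros simp: algebra_simps eval_nat_numeral)
  have contm: "continuous_on S h" for S
    unfolding h_def by (intro continuous_intros) auto
  have dec: "h v < h u" if "0 \<le> u" "u < v" "v \<le> c" for u v
  proof (rule DERIV_neg_imp_decreasing_open[OF that(2) _ contm])
    fix x assume x: "u < x" "x < v"
    have "x ^ 3 < c ^ 3" using x that by (intro power_strict_mono) auto
    then have "x * (5 * x ^ 3 - 1) < 0" using x that c3 by (intro mult_pos_neg) auto
    then show "\<exists>y. DERIV h x :> y \<and> y < 0" using h' by blast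
  qed
  have inc: "h u < h v" if "c \<le> u" "u < v" for u v
  proof (rule DERIV_pos_imp_increasing_open[OF that(2) _ contm])
    fix x assume x: "u < x" "x < v"
    have "c ^ 3 < x ^ 3" using x that c0 by (intro power_strict_mono) auto
    then have "0 < x * (5 * x ^ 3 - 1)" using x that c0 c3 by (intro mult_pos_pos) auto
    then show "\<exists>y. DERIV h x :> y \<and> 0 < y" using h' by blast
  qed
  have v: "sqrt (5 * k) < c"
  proof (rule real_less_lsqrt)
    show "5 * k < c\<^sup>2" unfolding c2 using k(2) by (simp add: field_simps)
  qed (use c0 k in auto)
  have h_v: "h (sqrt (5 * k)) < 0"
  proof -
    have "(sqrt (5 * k)) ^ 3 < c ^ 3" using v k by (intro power_strict_mono) auto
    then have "(sqrt (5 * k))\<^sup>2 * ((sqrt (5 * k)) ^ 3 - 1 / 5) < 0"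
      using k c3 by (intro mult_pos_neg) auto
    \<comment> \<open>At \<open>v = sqrt (5 * k)\<close> the constant term \<open>3 * k / 2\<close>
      becomes a multiple of \<open>v\<^sup>2\<close> and \<open>h\<close> factors; this is the
      origin of the factor 5.\<close>
    also have "(sqrt (5 * k))\<^sup>2 * ((sqrt (5 * k)) ^ 3 - 1 / 5) = h (sqrt (5 * k))"
    proof -
      have "v\<^sup>2 * (v ^ 3 - 1 / 5) = v ^ 5 - v\<^sup>2 / 2 + 3 * (v\<^sup>2 / 5) / 2" for v :: real
        by (simp add: algebra_simps eval_nat_numeral)
      from this[of "sqrt (5 * k)"] show ?thesis using k by (simp add: h_def)
    qed
    finally show ?thesis .
  qed
  have h_w: "0 < h (sqrt k)"
    using k by (simp add: h_def add_pos_pos)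
  have h_1: "0 < h 1"
    using k by (simp add: h_def)
  have "\<exists>u\<ge>sqrt k. u \<le> sqrt (5 * k) \<and> h u = 0"
    using h_w h_v k by (intro IVT2' contm) auto
  then obtain u1 where u1: "sqrt k \<le> u1" "u1 \<le> sqrt (5 * k)" "h u1 = 0" by blast
  have "h c < 0" using dec[OF _ v] h_v k by force
  then have "\<exists>u\<ge>c. u \<le> 1 \<and> h u = 0"
    using h_1 c1 by (intro IVT' contm) auto
  then obtain u2 where u2: "c \<le> u2" "u2 \<le> 1" "h u2 = 0" by blast
  have u1_nn: "0 \<le> u1" using u1 k by (meson order_trans real_sqrt_ge_zero less_imp_le)
  show ?thesis
  proof (rule that[of u1 u2])
    show "sqrt k < u1" "u1 < sqrt (5 * k)"
      using u1 h_w h_v by (auto simp: less_le)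
    show "sqrt (5 * k) < u2" using v u2 by linarith
    show "u2 < 1" using u2 h_1 by (auto simp: less_le)
    show "0 < h u" if "0 \<le> u" "u < u1" for u
      using dec[of u u1] that u1 v by linarith
    show "h u < 0" if "u1 < u" "u < u2" for u
      using dec[of u1 u] inc[of u u2] u1 u2 u1_nn that by (cases "u \<le> c") auto
    show "0 < h u" if "u2 < u" for u
      using inc[of u2 u] u2 that by linarith
  qed
qed

section \<open>Monotone branches of the load curve\<close>

lemma dead_load_has_derivative:
  assumes "0 < s" "\<mu>1 \<noteq> 0"
  shows "(dead_load \<mu>1 \<mu>2 has_real_derivative
     \<mu>1 / sqrt s ^ 5 * (sqrt s ^ 5 - (sqrt s)\<^sup>2 / 2 + 3 * (- \<mu>2 / \<mu>1) / 2)) (at s)"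
proof -
  define u where "u = sqrt s"
  have u: "0 < u" "s = u\<^sup>2" using assms by (auto simp: u_def)
  show ?thesis
    unfolding dead_load_def using assms
    apply (auto intro!: derivative_eq_intros)
    apply (fold u_def)
    using u(1) unfolding u(2)
    by (simp add: field_simps power2_eq_square eval_nat_numeral)
qed

text \<open>The extremal stretches are the squares of the two zeros of the slope polynomial. The
  first rising branch is stated from 0 on, below the Baker-Ericksen bound, because the infimum
  criterion supplies a stretch anywhere in the unit interval.\<close>

lemma dead_load_shape:
  assumes \<mu>1: "0 < \<mu>1" and \<mu>2: "- \<mu>1 / 5 powr (5/3) < \<mu>2" "\<mu>2 < 0"
  obtains smax smin where "- \<mu>2 / \<mu>1 < smax" "smax < - 5 * \<mu>2 / \<mu>1"
    "- 5 * \<mu>2 / \<mu>1 < smin" "smin < 1"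
    and "\<And>a b. 0 < a \<Longrightarrow> a < b \<Longrightarrow> b \<le> smax \<Longrightarrow> dead_load \<mu>1 \<mu>2 a < dead_load \<mu>1 \<mu>2 b"
    and "\<And>a b. smax \<le> a \<Longrightarrow> a < b \<Longrightarrow> b \<le> smin \<Longrightarrow> dead_load \<mu>1 \<mu>2 b < dead_load \<mu>1 \<mu>2 a"
    and "\<And>a b. smin \<le> a \<Longrightarrow> a < b \<Longrightarrow> dead_load \<mu>1 \<mu>2 a < dead_load \<mu>1 \<mu>2 b"
proof -
  define k where "k = - \<mu>2 / \<mu>1"
  have k: "0 < k" "k < 1 / 5 powr (5/3)"
    using assms by (auto simp: k_def field_simps)
  define h where "h u = u ^ 5 - u\<^sup>2 / 2 + 3 * k / 2" for u :: real
  obtain u1 u2 where u: "sqrt k < u1" "u1 < sqrt (5 * k)" "sqrt (5 * k) < u2" "u2 < 1"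
    and h: "\<And>u. 0 \<le> u \<Longrightarrow> u < u1 \<Longrightarrow> 0 < h u"
      "\<And>u. u1 < u \<Longrightarrow> u < u2 \<Longrightarrow> h u < 0" "\<And>u. u2 < u \<Longrightarrow> 0 < h u"
    unfolding h_def using slope_polynomial_signs[OF k] by metis
  have pos: "0 < u1" "0 < u2"
    using u k real_sqrt_gt_zero[of k] real_sqrt_gt_zero[of "5 * k"] by linarith+
  let ?\<tau> = "dead_load \<mu>1 \<mu>2"
  have d: "(?\<tau> has_real_derivative \<mu>1 / sqrt s ^ 5 * h (sqrt s)) (at s)" if "0 < s" for s
    using dead_load_has_derivative[OF that, of \<mu>1 \<mu>2] \<mu>1 unfolding h_def k_def by simp
  have cont: "continuous_on {a..b} ?\<tau>" if "0 < a" for a b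
    using d that by (intro DERIV_continuous_on[of _ _ "\<lambda>s. \<mu>1 / sqrt s ^ 5 * h (sqrt s)"])
      (auto intro: has_field_derivative_at_within)
  have inc: "?\<tau> a < ?\<tau> b"
    if "0 < a" "a < b" and hp: "\<And>x. a < x \<Longrightarrow> x < b \<Longrightarrow> 0 < h (sqrt x)" for a b
  proof (rule DERIV_pos_imp_increasing_open[OF that(2) _ cont[OF that(1)]])
    fix x assume x: "a < x" "x < b"
    then have "0 < \<mu>1 / sqrt x ^ 5 * h (sqrt x)" using \<mu>1 hp[OF x] that(1) by simp
    then show "\<exists>y. DERIV ?\<tau> x :> y \<and> 0 < y" using d[of x] x that(1) by force
  qed
  have dec: "?\<tau> b < ?\<tau> a"
    if "0 < a" "a < b" and hn: "\<And>x. a < x \<Longrightarrow> x < b \<Longrightarrow> h (sqrt x) < 0" for a b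
  proof (rule DERIV_neg_imp_decreasing_open[OF that(2) _ cont[OF that(1)]])
    fix x assume x: "a < x" "x < b"
    then have "\<mu>1 / sqrt x ^ 5 * h (sqrt x) < 0"
      using \<mu>1 hn[OF x] that(1) by (intro mult_pos_neg) auto
    then show "\<exists>y. DERIV ?\<tau> x :> y \<and> y < 0" using d[of x] x that(1) by force
  qed
  have sq: "sqrt s < v \<longleftrightarrow> s < v\<^sup>2" "v < sqrt s \<longleftrightarrow> v\<^sup>2 < s" if "0 < v" "0 < s" for s v
    using that by (metis abs_of_pos real_sqrt_abs real_sqrt_less_iff)+
  show ?thesis
  proof (rule that[of "u1\<^sup>2" "u2\<^sup>2"])
    show "- \<mu>2 / \<mu>1 < u1\<^sup>2" using u(1) sq[OF pos(1), of k] k by (simp add: k_def)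
    show "u1\<^sup>2 < - 5 * \<mu>2 / \<mu>1"
      using u(2) sq[OF pos(1), of "5 * k"] k by (simp add: k_def)
    show "- 5 * \<mu>2 / \<mu>1 < u2\<^sup>2"
      using u(3) sq[OF pos(2), of "5 * k"] k by (simp add: k_def)
    show "u2\<^sup>2 < 1" using u(4) pos by (simp add: power_less_one_iff)
    show "?\<tau> a < ?\<tau> b" if "0 < a" "a < b" "b \<le> u1\<^sup>2" for a b
      using that sq[OF pos(1)] by (intro inc h) auto
    show "?\<tau> b < ?\<tau> a" if "u1\<^sup>2 \<le> a" "a < b" "b \<le> u2\<^sup>2" for a b
    proof -
      have "0 < a" using that pos(1) zero_less_power[of u1 2] by linarith
      then show ?thesis
        using that sq[OF pos(1)] sq[OF pos(2)] by (intro dec h) auto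
    qed
    show "?\<tau> a < ?\<tau> b" if "u2\<^sup>2 \<le> a" "a < b" for a b
    proof -
      have "0 < a" using that pos(2) zero_less_power[of u2 2] by linarith
      then show ?thesis
        using that sq[OF pos(2)] by (intro inc h) auto
    qed
  qed
qed

subsection \<open>The threshold for buckling before the reference state loses stability\<close>

text \<open>In \<open>u = sqrt s\<close> numerator and denominator share the factor
  \<open>u - 1\<close>; cancelling it leaves a positive denominator and removes the singularity at
  1.\<close>

lemma infimum_integrand:
  fixes s :: real
  assumes "0 < s" "s < 1"
  defines "u \<equiv> sqrt s"
  shows "(s powr (5/2) - 2 * s powr (3/2) + s) / (s powr (3/2) - 1) = u\<^sup>2 * (u\<^sup>2 + u - 1) / (u\<^sup>2 + u + 1)"
proof -
  have u: "0 < u" "u < 1" "s = u\<^sup>2" using assms by auto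
  have p: "s powr (real n / 2) = u ^ n" for n
  proof -
    have "s powr (real n / 2) = (s powr (1/2)) powr real n" by (simp add: powr_powr)
    then show ?thesis using u by (simp add: powr_half_sqrt powr_realpow u_def[symmetric] assms(1))
  qed
  have 1: "u ^ 5 - 2 * u ^ 3 + u\<^sup>2 = (u - 1) * (u\<^sup>2 * (u\<^sup>2 + u - 1))"
    and 2: "u ^ 3 - 1 = (u - 1) * (u\<^sup>2 + u + 1)"
    by (simp_all add: algebra_simps eval_nat_numeral)
  have "(s powr (5/2) - 2 * s powr (3/2) + s) / (s powr (3/2) - 1) =
      (u ^ 5 - 2 * u ^ 3 + u\<^sup>2) / (u ^ 3 - 1)"
    using p[of 5] p[of 3] u(3) by simp
  also have "\<dots> = u\<^sup>2 * (u\<^sup>2 + u - 1) / (u\<^sup>2 + u + 1)"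
    unfolding 1 2 using u(2) by simp
  finally show ?thesis .
qed

text \<open>The quotient is the value of \<open>\<mu>2 / \<mu>1\<close> at which the load at
  \<open>s\<close> equals the critical load \<open>2 * (\<mu>1 + \<mu>2)\<close>. The difference of
  the two loads is affine in \<open>\<mu>2\<close>, with positive slope after the factor
  \<open>(1 - u) / u ^ 3\<close> is split off.\<close>

lemma dead_load_exceeds_iff:
  assumes "0 < \<mu>1" and s: "0 < s" "s < 1"
  shows "2 * (\<mu>1 + \<mu>2) < dead_load \<mu>1 \<mu>2 s \<longleftrightarrow>
    (s powr (5/2) - 2 * s powr (3/2) + s) / (s powr (3/2) - 1) < \<mu>2 / \<mu>1"
proof -
  define u where "u = sqrt s"
  have u: "0 < u" "u < 1" "s = u\<^sup>2" using s by (auto simp: u_def)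
  let ?d = "u\<^sup>2 + u + 1"
  have d: "0 < ?d" using u by (simp add: add_pos_pos)
  have "dead_load \<mu>1 \<mu>2 s - 2 * (\<mu>1 + \<mu>2) =
      (1 - u) / u ^ 3 * (\<mu>2 * ?d - \<mu>1 * (u\<^sup>2 * (u\<^sup>2 + u - 1)))"
    unfolding dead_load_def u_def[symmetric] u(3) using u(1)
    by (simp add: field_simps eval_nat_numeral)
  moreover have "0 < (1 - u) / u ^ 3" using u by simp
  ultimately have "2 * (\<mu>1 + \<mu>2) < dead_load \<mu>1 \<mu>2 s \<longleftrightarrow> \<mu>1 * (u\<^sup>2 * (u\<^sup>2 + u - 1)) < \<mu>2 * ?d"
    by (smt (verit) zero_less_mult_iff)
  also have "\<dots> \<longleftrightarrow> u\<^sup>2 * (u\<^sup>2 + u - 1) / ?d < \<mu>2 / \<mu>1"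
    by (simp only: pos_divide_less_eq[OF d] times_divide_eq_left pos_less_divide_eq[OF assms(1)]
        mult.commute[of \<mu>1])
  finally show ?thesis using infimum_integrand[OF s] by (simp add: u_def)
qed

lemma infimum_bounds:
  "\<bar>(INF s\<in>{0<..<1::real}. (s powr (5/2) - 2 * s powr (3/2) + s) / (s powr (3/2) - 1))
         - (- 0.045)\<bar> < 0.0005"
proof -
  let ?q = "\<lambda>s::real. (s powr (5/2) - 2 * s powr (3/2) + s) / (s powr (3/2) - 1)"
  have lower: "- 0.0454 \<le> ?q s" if s: "s \<in> {0<..<1}" for s
  proof -
    define u where "u = sqrt s"
    have u: "0 < u" using s by (simp add: u_def)
    \<comment> \<open>The minimiser is close to \<open>u = 0.3925\<close>.\<close>
    have "0 \<le> (u - 0.3925)\<^sup>2 * (u\<^sup>2 + 1.785 * u + 0.29256875)"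
      using u by simp
    \<comment> \<open>The quadratic factor is fitted so that the coefficients of
      \<open>u ^ 4\<close>, \<open>u ^ 3\<close> and \<open>u\<^sup>2\<close> agree; the linear and
      constant coefficients leave a small positive slack.\<close>
    also have "\<dots> \<le> u\<^sup>2 * (u\<^sup>2 + u - 1) + 0.0454 * (u\<^sup>2 + u + 1)"
      using u by (simp add: algebra_simps power2_eq_square)
    finally have "0 \<le> u\<^sup>2 * (u\<^sup>2 + u - 1) + 0.0454 * (u\<^sup>2 + u + 1)" .
    then have "- 0.0454 \<le> u\<^sup>2 * (u\<^sup>2 + u - 1) / (u\<^sup>2 + u + 1)"
      using u by (subst le_divide_eq) (auto simp: add_pos_pos algebra_simps)
    then show ?thesis using infimum_integrand[of s] s by (simp add: u_def)
  qed
  have "bdd_below (?q ` {0<..<1})"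
    using lower by (intro bdd_belowI2)
  \<comment> \<open>\<open>0.16\<close> is the square of \<open>0.4\<close>, a convenient value of
    \<open>u\<close> near the minimiser.\<close>
  then have "(INF s\<in>{0<..<1}. ?q s) \<le> ?q 0.16"
    by (intro cINF_lower) auto
  also have "?q 0.16 \<le> - 0.045"
  proof -
    have "sqrt (0.16::real) = 0.4" by (rule real_sqrt_unique) (auto simp: power2_eq_square)
    then show ?thesis
      using infimum_integrand[of "0.16"] by (simp only:) (simp add: power2_eq_square)
  qed
  finally have "(INF s\<in>{0<..<1}. ?q s) \<le> - 0.045" .
  moreover have "- 0.0454 \<le> (INF s\<in>{0<..<1}. ?q s)"
    using lower by (intro cINF_greatest) auto
  moreover have "\<bar>x - (- 0.045)\<bar> < 0.0005" if "x \<le> - 0.045" "- 0.0454 \<le> x" for x :: real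
    using that by (simp add: abs_if)
  ultimately show ?thesis by blast
qed

section \<open>Equilibria and energies with two equal stretches\<close>

lemma two_equal_stretches_nth [simp]:
  "two_equal_stretches s $ 1 = s" "two_equal_stretches s $ 2 = 1 / sqrt s"
  "two_equal_stretches s $ 3 = 1 / sqrt s"
  by (simp_all add: two_equal_stretches_def)

text \<open>If \<open>x\<close> and \<open>y\<close> are two of three stretches with product 1, then
  \<open>1 / (x * y)\<^sup>2\<close> is the square of the third, so the last factor is the
  Baker-Ericksen expression.\<close>

lemma cauchy_stress_diff:
  assumes "x \<noteq> 0" "y \<noteq> 0"
  shows "cauchy_stress \<mu>1 \<mu>2 p x - cauchy_stress \<mu>1 \<mu>2 p y = (x - y) * (x + y) * (\<mu>1 + \<mu>2 / (x * y)\<^sup>2)"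
proof -
  have "\<mu>2 / y\<^sup>2 - \<mu>2 / x\<^sup>2 = \<mu>2 * ((x - y) * (x + y)) / (x * y)\<^sup>2"
    using assms by (simp add: divide_simps) (simp add: algebra_simps power2_eq_square)
  then show ?thesis
    by (simp add: cauchy_stress_def algebra_simps power2_eq_square)
qed

lemma baker_ericksen_two_equal_stretches:
  assumes "0 < \<mu>1" "0 < s" "s \<noteq> 1"
  shows "baker_ericksen \<mu>1 \<mu>2 (two_equal_stretches s) \<longleftrightarrow> - \<mu>2 / \<mu>1 < s"
proof -
  define u where "u = sqrt s"
  have u: "0 < u" "s = u\<^sup>2" using assms by (auto simp: u_def)
  have ne: "s \<noteq> 1 / u"
  proof
    assume "s = 1 / u"
    then have "u ^ 3 = 1 ^ 3" using u by (simp add: field_simps eval_nat_numeral)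
    then have "u = 1" using u(1) power_eq_imp_eq_base[of u 3 1] by simp
    then show False using u assms by simp
  qed
  let ?T = "cauchy_stress \<mu>1 \<mu>2"
  have T: "(?T p s - ?T p (1 / u)) * (s - 1 / u) =
      (s - 1 / u)\<^sup>2 * (s + 1 / u) * (\<mu>1 + \<mu>2 / s)" for p
  proof -
    have "(s * (1 / u))\<^sup>2 = s" using u by (simp add: power2_eq_square)
    then show ?thesis
      using cauchy_stress_diff[of s "1 / u" \<mu>1 \<mu>2 p] u(1) assms(2)
      by (simp add: power2_eq_square)
  qed
  have T': "(?T p (1 / u) - ?T p s) * (1 / u - s) =
      (s - 1 / u)\<^sup>2 * (s + 1 / u) * (\<mu>1 + \<mu>2 / s)" for p
    unfolding T[of p, symmetric] by (simp add: algebra_simps)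
  have "0 < (s - 1 / u)\<^sup>2 * (s + 1 / u)"
    using ne assms u(1) by (intro mult_pos_pos) (auto intro: add_pos_pos)
  moreover have *: "0 < \<mu>1 + \<mu>2 / s \<longleftrightarrow> - \<mu>2 / \<mu>1 < s"
    using pos_less_divide_eq[OF assms(2), of "- \<mu>1" \<mu>2] pos_divide_less_eq[OF assms(1), of "- \<mu>2" s]
    by (simp only: mult.commute[of s]) linarith
  ultimately have "0 < (s - 1 / u)\<^sup>2 * (s + 1 / u) * (\<mu>1 + \<mu>2 / s) \<longleftrightarrow> - \<mu>2 / \<mu>1 < s"
    using mult_less_cancel_left_pos[of "(s - 1 / u)\<^sup>2 * (s + 1 / u)" 0 "\<mu>1 + \<mu>2 / s"] *
    by (simp only: mult_zero_right)
  then show ?thesis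
    using ne unfolding baker_ericksen_def
    by (auto simp: forall_3 T T' u_def[symmetric])
qed

text \<open>Two of the three equations coincide. Eliminating the pressure from the remaining pair
  leaves a product of \<open>u ^ 3 - 1\<close> with \<open>\<tau>\<close> minus the load, where
  \<open>u = sqrt s\<close>; the first factor vanishes only in the reference state.\<close>

lemma triaxial_equilibrium_two_equal_stretches:
  assumes "0 < s" "s \<noteq> 1"
  shows "triaxial_equilibrium \<mu>1 \<mu>2 \<tau> (two_equal_stretches s) \<longleftrightarrow> \<tau> = dead_load \<mu>1 \<mu>2 s"
proof -
  define u where "u = sqrt s"
  have u: "0 < u" "s = u\<^sup>2" using assms by (auto simp: u_def)
  have u3: "u ^ 3 \<noteq> 1"
  proof
    assume "u ^ 3 = 1"
    then have "u = 1" using u(1) power_eq_imp_eq_base[of u 3 1] by simp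
    then show False using u assms by simp
  qed
  have *: "(\<exists>p. - p / s + A - A' = \<tau> \<and> - p / (1 / u) + B - B' = \<tau>)
     \<longleftrightarrow> s * (A - A' - \<tau>) = (B - B' - \<tau>) / u" for A A' B B'
  proof
    assume "\<exists>p. - p / s + A - A' = \<tau> \<and> - p / (1 / u) + B - B' = \<tau>"
    then obtain p where "- p / s + A - A' = \<tau>" "- p / (1 / u) + B - B' = \<tau>" by blast
    then have "A - A' - \<tau> = p / s" "B - B' - \<tau> = p * u" by simp_all
    then show "s * (A - A' - \<tau>) = (B - B' - \<tau>) / u"
      using u(1) assms(1) by (simp only:) simp
  next
    assume r: "s * (A - A' - \<tau>) = (B - B' - \<tau>) / u"
    define p where "p = s * (A - A' - \<tau>)"
    have "p / s = A - A' - \<tau>" using assms(1) by (simp add: p_def)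
    moreover have "p / (1 / u) = B - B' - \<tau>"
      using u(1) unfolding p_def r by simp
    ultimately show "\<exists>p. - p / s + A - A' = \<tau> \<and> - p / (1 / u) + B - B' = \<tau>"
      by (intro exI[of _ p]) (simp add: minus_divide_left[symmetric] del: divide_divide_eq_right)
  qed
  have "(\<exists>p. - p / s + \<mu>1 * s - \<mu>2 / s ^ 3 = \<tau> \<and> - p / (1 / u) + \<mu>1 * (1 / u) - \<mu>2 / (1 / u) ^ 3 = \<tau>)
     \<longleftrightarrow> s * (\<mu>1 * s - \<mu>2 / s ^ 3 - \<tau>) = (\<mu>1 * (1 / u) - \<mu>2 / (1 / u) ^ 3 - \<tau>) / u"
    (is "?A \<longleftrightarrow> ?B") by (rule *)
  also have "?B \<longleftrightarrow> (u ^ 3 - 1) * (\<tau> - (\<mu>1 + \<mu>2 / s) * (s + 1 / u)) = 0"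
  proof -
    have "s * (\<mu>1 * s - \<mu>2 / s ^ 3 - \<tau>) - (\<mu>1 * (1 / u) - \<mu>2 / (1 / u) ^ 3 - \<tau>) / u =
        - ((u ^ 3 - 1) * (\<tau> - (\<mu>1 + \<mu>2 / s) * (s + 1 / u))) / u"
      unfolding u(2) using u(1) by (simp add: field_simps eval_nat_numeral)
    then show ?thesis using u(1) by auto
  qed
  also have "\<dots> \<longleftrightarrow> \<tau> = (\<mu>1 + \<mu>2 / s) * (s + 1 / u)"
    using u3 by simp
  finally show ?thesis
    using assms u(1) u(2) unfolding triaxial_equilibrium_def dead_load_def
    by (simp add: forall_3 u_def[symmetric] power2_eq_square)
qed

section \<open>Energy along and transverse to the family with two equal stretches\<close>

definition plate_energy :: "real \<Rightarrow> real \<Rightarrow> real \<Rightarrow> real \<Rightarrow> real" where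
  "plate_energy \<mu>1 \<mu>2 \<tau> s = mooney_rivlin \<mu>1 \<mu>2 (two_equal_stretches s) - \<tau> * (s + 2 / sqrt s)"

lemma plate_energy_has_derivative:
  assumes "0 < s"
  shows "(plate_energy \<mu>1 \<mu>2 \<tau> has_real_derivative
     (dead_load \<mu>1 \<mu>2 s - \<tau>) * (1 - 1 / sqrt s ^ 3)) (at s)"
proof -
  define u where "u = sqrt s"
  have u: "0 < u" "s = u\<^sup>2" using assms by (auto simp: u_def)
  show ?thesis
    unfolding plate_energy_def mooney_rivlin_def dead_load_def using assms
    apply (auto intro!: derivative_eq_intros)
    apply (fold u_def)
    using u(1) unfolding u(2)
    by (simp add: field_simps power2_eq_square eval_nat_numeral)
qed

text \<open>Below 1 the factor \<open>1 - 1 / sqrt s ^ 3\<close> is negative, so a descending branch of the load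
  curve carries the minima of the energy.\<close>

lemma plate_energy_min:
  assumes pos: "0 < p" and q: "q \<le> 1"
    and dec: "\<And>a b. p \<le> a \<Longrightarrow> a < b \<Longrightarrow> b \<le> q \<Longrightarrow> dead_load \<mu>1 \<mu>2 b < dead_load \<mu>1 \<mu>2 a"
    and s: "p \<le> s" "s \<le> q" and a: "p \<le> a" "a \<le> q"
  shows "plate_energy \<mu>1 \<mu>2 (dead_load \<mu>1 \<mu>2 s) s \<le> plate_energy \<mu>1 \<mu>2 (dead_load \<mu>1 \<mu>2 s) a"
proof -
  let ?g = "plate_energy \<mu>1 \<mu>2 (dead_load \<mu>1 \<mu>2 s)"
  have f: "1 - 1 / sqrt x ^ 3 \<le> 0" if "p \<le> x" "x \<le> q" for x
    using that pos q by (simp add: power_le_one)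
  show ?thesis
  proof (cases "s \<le> a")
    case True
    then show ?thesis
    proof (rule DERIV_nonneg_imp_nondecreasing)
      fix x assume x: "s \<le> x" "x \<le> a"
      have "dead_load \<mu>1 \<mu>2 x \<le> dead_load \<mu>1 \<mu>2 s"
        using dec[of s x] x s a by (cases "x = s") auto
      moreover have "p \<le> x" "x \<le> q" "0 < x" using x s a pos by auto
      ultimately show "\<exists>y. DERIV ?g x :> y \<and> 0 \<le> y"
        using plate_energy_has_derivative[of x \<mu>1 \<mu>2 "dead_load \<mu>1 \<mu>2 s"] f[of x]
          mult_nonpos_nonpos[of "dead_load \<mu>1 \<mu>2 x - dead_load \<mu>1 \<mu>2 s" "1 - 1 / sqrt x ^ 3"]
        by (meson diff_ge_0_iff_ge diff_le_0_iff_le)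
    qed
  next
    case False
    then have "a \<le> s" by simp
    then show ?thesis
    proof (rule DERIV_nonpos_imp_nonincreasing)
      fix x assume x: "a \<le> x" "x \<le> s"
      have "dead_load \<mu>1 \<mu>2 s \<le> dead_load \<mu>1 \<mu>2 x"
        using dec[of x s] x s a by (cases "x = s") auto
      moreover have "p \<le> x" "x \<le> q" "0 < x" using x s a pos by auto
      ultimately show "\<exists>y. DERIV ?g x :> y \<and> y \<le> 0"
        using plate_energy_has_derivative[of x \<mu>1 \<mu>2 "dead_load \<mu>1 \<mu>2 s"] f[of x]
          mult_nonneg_nonpos[of "dead_load \<mu>1 \<mu>2 x - dead_load \<mu>1 \<mu>2 s" "1 - 1 / sqrt x ^ 3"]
        by (meson diff_ge_0_iff_ge diff_le_0_iff_le)
    qed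
  qed
qed

text \<open>With \<open>m = 1 / sqrt a\<close> the excess \<open>q = b + c - 2 * m\<close> is
  nonnegative by the inequality of arithmetic and geometric means, and the energy gap is exactly
  \<open>q * ((q / 2 + 2 * m) * (\<mu>1 + \<mu>2 * a\<^sup>2) - \<tau>)\<close>. Both conditions on
  the load and the coefficients involve \<open>a\<close> alone, so the bound is global in
  \<open>b\<close> and \<open>c\<close>.\<close>

lemma plate_energy_le:
  fixes a b c :: real
  assumes pos: "0 < a" "0 < b" "0 < c" and abc: "a * b * c = 1"
    and shear: "\<tau> \<le> 2 / sqrt a * (\<mu>1 + \<mu>2 * a\<^sup>2)" and "0 \<le> \<mu>1 + \<mu>2 * a\<^sup>2"
  shows "plate_energy \<mu>1 \<mu>2 \<tau> a \<le> mooney_rivlin \<mu>1 \<mu>2 (vector [a, b, c]) - \<tau> * (a + b + c)"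
proof -
  define m where "m = 1 / sqrt a"
  define q where "q = b + c - 2 * m"
  have m: "0 < m" "1 / m\<^sup>2 = a" using pos by (simp_all add: m_def power_divide)
  then have a: "a = 1 / m\<^sup>2" "sqrt a = 1 / m" by (simp_all add: m_def)
  have bc: "b * c = m\<^sup>2" using abc m(1) by (simp add: a field_simps)
  have "0 \<le> q"
  proof -
    have "(2 * m)\<^sup>2 \<le> (b + c)\<^sup>2"
      using sum_power2_ge_zero[of "b - c" 0] bc by (simp add: power2_eq_square algebra_simps)
    then have "2 * m \<le> b + c" by (rule power2_le_imp_le) (use pos in simp)
    then show ?thesis by (simp add: q_def)
  qed
  have inv: "1 / b\<^sup>2 + 1 / c\<^sup>2 = (b\<^sup>2 + c\<^sup>2) * a\<^sup>2"
  proof -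
    have "1 / b = a * c" "1 / c = a * b" using abc pos by (simp_all add: field_simps)
    then have "1 / b\<^sup>2 = (a * c)\<^sup>2" "1 / c\<^sup>2 = (a * b)\<^sup>2" by (metis power_one_over)+
    then show ?thesis by (simp add: power_mult_distrib algebra_simps)
  qed
  have m2: "1 / m\<^sup>2 = m\<^sup>2 * a\<^sup>2" using m by (simp add: a field_simps)
  have bcq: "b\<^sup>2 + c\<^sup>2 - 2 * m\<^sup>2 = q * (q + 4 * m)"
    unfolding q_def using bc by algebra
  have "mooney_rivlin \<mu>1 \<mu>2 (vector [a, b, c]) - \<tau> * (a + b + c) - plate_energy \<mu>1 \<mu>2 \<tau> a =
      (b\<^sup>2 + c\<^sup>2 - 2 * m\<^sup>2) / 2 * (\<mu>1 + \<mu>2 * a\<^sup>2) - \<tau> * q"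
  proof -
    have 1: "mooney_rivlin \<mu>1 \<mu>2 (vector [a, b, c]) =
        \<mu>1 / 2 * (a\<^sup>2 + b\<^sup>2 + c\<^sup>2 - 3) + \<mu>2 / 2 * (1 / a\<^sup>2 + (b\<^sup>2 + c\<^sup>2) * a\<^sup>2 - 3)"
      by (simp add: mooney_rivlin_def inv[symmetric] add.assoc)
    have 2: "mooney_rivlin \<mu>1 \<mu>2 (two_equal_stretches a) =
        \<mu>1 / 2 * (a\<^sup>2 + 2 * m\<^sup>2 - 3) + \<mu>2 / 2 * (1 / a\<^sup>2 + 2 * m\<^sup>2 * a\<^sup>2 - 3)"
      unfolding mooney_rivlin_def two_equal_stretches_nth m_def[symmetric] m2
      by (simp only: mult_2 distrib_right add.assoc)
    have 3: "2 / sqrt a = 2 * m"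
      by (simp add: m_def)
    show ?thesis
      unfolding plate_energy_def q_def 1 2 3
      by (simp add: algebra_simps add_divide_distrib diff_divide_distrib)
  qed
  also have "\<dots> = q * ((q / 2 + 2 * m) * (\<mu>1 + \<mu>2 * a\<^sup>2) - \<tau>)"
    unfolding bcq by (simp add: field_simps)
  also have "\<dots> \<ge> 0"
  proof (rule mult_nonneg_nonneg[OF \<open>0 \<le> q\<close>])
    have "\<tau> \<le> 2 * m * (\<mu>1 + \<mu>2 * a\<^sup>2)" using shear by (simp add: m_def)
    also have "\<dots> \<le> (q / 2 + 2 * m) * (\<mu>1 + \<mu>2 * a\<^sup>2)"
      using \<open>0 \<le> q\<close> assms(6) by (intro mult_right_mono) auto
    finally show "0 \<le> (q / 2 + 2 * m) * (\<mu>1 + \<mu>2 * a\<^sup>2) - \<tau>" by simp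
  qed
  finally show ?thesis by simp
qed

text \<open>The right-hand side is the load beyond which equal transverse stretches cease to
  minimise. The strict inequality at \<open>s\<close> persists for nearby stretches by continuity,
  which supplies the load condition of \<open>plate_energy_le\<close>.\<close>

lemma dead_load_shear_bound:
  assumes "\<mu>2 < 0" "0 < \<mu>1" and s: "0 < s" "s < 1"
  shows "dead_load \<mu>1 \<mu>2 s < 2 / sqrt s * (\<mu>1 + \<mu>2 * s\<^sup>2)"
proof -
  define u where "u = sqrt s"
  have u: "0 < u" "u < 1" "s = u\<^sup>2" using s by (auto simp: u_def)
  have p: "u ^ 3 < 1" "u ^ 3 * u ^ 3 < 1" using u by (simp_all add: power_Suc_less_one power_less_one_iff flip: power_add)
  have "0 < \<mu>1 * (1 - u ^ 3) / u + (- \<mu>2) * ((1 - u ^ 3 * u ^ 3) + u ^ 3 * (1 - u ^ 3)) / u ^ 3"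
    using assms p u by (intro add_pos_pos divide_pos_pos mult_pos_pos) auto
  also have "\<dots> = 2 / u * (\<mu>1 + \<mu>2 * (u\<^sup>2)\<^sup>2) - (\<mu>1 + \<mu>2 / u\<^sup>2) * (u\<^sup>2 + 1 / u)"
    using u(1) by (simp add: field_simps eval_nat_numeral)
  finally show ?thesis
    unfolding dead_load_def u_def[symmetric] by (simp add: u(3))
qed

section \<open>Strain energy as a function of the deformation gradient\<close>

lemma diag_matrix_mult: "diag_matrix a ** diag_matrix b = diag_matrix (\<chi> i. a$i * b$i)"
  by (simp add: diag_matrix_def matrix_matrix_mult_def vec_eq_iff forall_3 sum_3)

lemma stretch_decomposition:
  assumes "singular_values F l"
  obtains P Q where "orthogonal_matrix P" "orthogonal_matrix Q"
    "F = P ** diag_matrix l ** transpose Q"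
    "transpose F ** F = Q ** diag_matrix (\<chi> i. (l$i)\<^sup>2) ** transpose Q"
proof -
  obtain P Q where PQ: "orthogonal_matrix P" "orthogonal_matrix Q"
    and F: "F = P ** diag_matrix l ** transpose Q"
    using assms unfolding singular_values_def by blast
  have t: "transpose (diag_matrix l) = diag_matrix l"
    by (auto simp: diag_matrix_def transpose_def vec_eq_iff)
  have sq: "diag_matrix l ** diag_matrix l = diag_matrix (\<chi> i. (l$i)\<^sup>2)"
    by (simp add: diag_matrix_mult power2_eq_square)
  have "transpose F ** F = Q ** diag_matrix l ** (transpose P ** P) ** diag_matrix l ** transpose Q"
    by (simp add: F matrix_transpose_mul t matrix_mul_assoc)
  also have "\<dots> = Q ** (diag_matrix l ** diag_matrix l) ** transpose Q"
    using PQ by (simp add: orthogonal_matrix_def matrix_mul_assoc)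
  finally show ?thesis
    using that[OF PQ F] by (simp add: sq)
qed

lemma trace_conj_orthogonal:
  fixes Q :: "real^3^3"
  assumes "orthogonal_matrix Q"
  shows "trace (Q ** A ** transpose Q) = trace A"
  using assms
  by (metis trace_mul_sym matrix_mul_assoc matrix_mul_lid orthogonal_matrix_def)

lemma trace_diag_matrix: "trace (diag_matrix l) = l$1 + l$2 + l$3"
  by (simp add: trace_3 diag_matrix_def)

lemma det_diag_matrix: "det (diag_matrix l) = l$1 * l$2 * l$3"
  by (simp add: det_3 diag_matrix_def)

text \<open>\<open>C\<close> is an orthogonal conjugate of the diagonal matrix of squared stretches.
  The two traces make the energy independent of the chosen stretches; the characteristic polynomial
  detects a stretch close to a given number.\<close>

lemma right_stretch_invariants:
  assumes "singular_values F l"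
  defines "C \<equiv> transpose F ** F"
  shows "trace C = (l$1)\<^sup>2 + (l$2)\<^sup>2 + (l$3)\<^sup>2"
    and "trace (C ** C) = (l$1) ^ 4 + (l$2) ^ 4 + (l$3) ^ 4"
    and "det (C - x *\<^sub>R mat 1) = ((l$1)\<^sup>2 - x) * ((l$2)\<^sup>2 - x) * ((l$3)\<^sup>2 - x)"
proof -
  obtain P Q where Q: "orthogonal_matrix Q"
    and C: "C = Q ** diag_matrix (\<chi> i. (l$i)\<^sup>2) ** transpose Q"
    using stretch_decomposition[OF assms(1)] unfolding C_def by metis
  show "trace C = (l$1)\<^sup>2 + (l$2)\<^sup>2 + (l$3)\<^sup>2"
    by (simp add: C trace_conj_orthogonal[OF Q] trace_diag_matrix)
  let ?D = "diag_matrix (\<chi> i. (l$i)\<^sup>2)"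
  have "C ** C = Q ** ?D ** (transpose Q ** Q) ** ?D ** transpose Q"
    by (simp add: C matrix_mul_assoc)
  also have "\<dots> = Q ** (?D ** ?D) ** transpose Q"
    using Q by (simp add: orthogonal_matrix_def matrix_mul_assoc)
  finally have "trace (C ** C) = trace (?D ** ?D)"
    by (simp only: trace_conj_orthogonal[OF Q])
  then show "trace (C ** C) = (l$1) ^ 4 + (l$2) ^ 4 + (l$3) ^ 4"
    by (simp add: diag_matrix_mult trace_diag_matrix flip: power_add)
  have "C - x *\<^sub>R mat 1 = Q ** ?D ** transpose Q - x *\<^sub>R (Q ** transpose Q)"
    using Q by (simp add: C orthogonal_matrix_def)
  also have "\<dots> = Q ** diag_matrix (\<chi> i. (l$i)\<^sup>2 - x) ** transpose Q"
    by (simp add: vec_eq_iff matrix_matrix_mult_def diag_matrix_def sum_3 forall_3 algebra_simps)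
  finally have "det (C - x *\<^sub>R mat 1) =
      det Q * det Q * (((l$1)\<^sup>2 - x) * ((l$2)\<^sup>2 - x) * ((l$3)\<^sup>2 - x))"
    by (simp add: det_mul det_diag_matrix)
  moreover have "det Q * det Q = 1"
    using det_orthogonal_matrix[OF Q] by auto
  ultimately show "det (C - x *\<^sub>R mat 1) = ((l$1)\<^sup>2 - x) * ((l$2)\<^sup>2 - x) * ((l$3)\<^sup>2 - x)"
    by simp
qed

text \<open>The orthogonal factors have determinant 1 or -1, so the product of the stretches is 1 up
  to sign, and it is nonnegative.\<close>

lemma isochoric_stretches:
  assumes l: "singular_values F l" and "det F = 1"
  shows "0 < l$i" and "l$1 * l$2 * l$3 = 1"
proof -
  obtain P Q where PQ: "orthogonal_matrix P" "orthogonal_matrix Q"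
    and F: "F = P ** diag_matrix l ** transpose Q"
    using l unfolding singular_values_def by blast
  have nn: "0 \<le> l$j" for j using l unfolding singular_values_def by blast
  have "det P * (l$1 * l$2 * l$3) * det Q = 1"
    using assms(2) by (simp add: F det_mul det_diag_matrix)
  then have "l$1 * l$2 * l$3 = 1 \<or> l$1 * l$2 * l$3 = - 1"
    using det_orthogonal_matrix[OF PQ(1)] det_orthogonal_matrix[OF PQ(2)] by auto
  moreover have "0 \<le> l$1 * l$2 * l$3" using nn by simp
  ultimately show prod: "l$1 * l$2 * l$3 = 1" by linarith
  then have "l$1 \<noteq> 0" "l$2 \<noteq> 0" "l$3 \<noteq> 0" by auto
  then show "0 < l$i" using nn[of i] exhaust_3[of i] by (auto simp: less_le)
qed

text \<open>\<open>strain_energy\<close> in terms of the principal invariants, hence a polynomial in the entries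
  of the gradient: for stretches of product 1,
  \<open>\<Sum>i. 1 / (l$i)\<^sup>2 = ((\<Sum>i. (l$i)\<^sup>2)\<^sup>2 - (\<Sum>i. (l$i) ^ 4)) / 2\<close>.\<close>

definition polynomial_energy :: "real \<Rightarrow> real \<Rightarrow> real^3^3 \<Rightarrow> real" where
  "polynomial_energy \<mu>1 \<mu>2 F = (let C = transpose F ** F in
     \<mu>1 / 2 * (trace C - 3) + \<mu>2 / 2 * (((trace C)\<^sup>2 - trace (C ** C)) / 2 - 3))"

lemma mooney_rivlin_eq_polynomial_energy:
  assumes l: "singular_values F l" and "l$1 * l$2 * l$3 = 1"
  shows "mooney_rivlin \<mu>1 \<mu>2 l = polynomial_energy \<mu>1 \<mu>2 F"
proof -
  have inv: "1 / a\<^sup>2 = (b * c)\<^sup>2" if "a * b * c = 1" for a b c :: real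
  proof -
    have "a \<noteq> 0" using that by auto
    then have "1 / a = b * c" using that by (simp add: field_simps)
    then show ?thesis by (metis power_one_over)
  qed
  have "1 / (l$1)\<^sup>2 = (l$2 * l$3)\<^sup>2" "1 / (l$2)\<^sup>2 = (l$1 * l$3)\<^sup>2" "1 / (l$3)\<^sup>2 = (l$1 * l$2)\<^sup>2"
    using assms(2) by (auto intro!: inv simp: ac_simps)
  moreover have "((l$1)\<^sup>2 + (l$2)\<^sup>2 + (l$3)\<^sup>2)\<^sup>2 - ((l$1) ^ 4 + (l$2) ^ 4 + (l$3) ^ 4) =
      2 * ((l$2 * l$3)\<^sup>2 + (l$1 * l$3)\<^sup>2 + (l$1 * l$2)\<^sup>2)"
    by (simp add: power2_eq_square eval_nat_numeral algebra_simps)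
  ultimately show ?thesis
    unfolding mooney_rivlin_def polynomial_energy_def Let_def right_stretch_invariants[OF l]
    by simp
qed

text \<open>The chosen and the given stretches both yield \<open>polynomial_energy\<close>; this
  takes the place of uniqueness of singular values up to order.\<close>

lemma strain_energy_eq_mooney_rivlin:
  assumes "singular_values F l" and "l$1 * l$2 * l$3 = 1" and "det F = 1"
  shows "strain_energy \<mu>1 \<mu>2 F = mooney_rivlin \<mu>1 \<mu>2 l"
proof -
  have S: "singular_values F (SOME l. singular_values F l)"
    using assms(1) by (rule someI)
  show ?thesis
    unfolding strain_energy_def
    using mooney_rivlin_eq_polynomial_energy[OF S isochoric_stretches(2)[OF S assms(3)]]
      mooney_rivlin_eq_polynomial_energy[OF assms(1,2)] by simp
qed

lemma strain_energy_eq_polynomial_energy: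
  assumes "det F = 1"
  shows "strain_energy \<mu>1 \<mu>2 F = polynomial_energy \<mu>1 \<mu>2 F"
proof -
  obtain l where l: "singular_values F l" using singular_values_exist by blast
  note p = isochoric_stretches(2)[OF l assms]
  show ?thesis
    using strain_energy_eq_mooney_rivlin[OF l p assms] mooney_rivlin_eq_polynomial_energy[OF l p]
    by simp
qed

lemma singular_values_diag_matrix:
  assumes "\<And>i. 0 \<le> l$i" shows "singular_values (diag_matrix l) l"
  unfolding singular_values_def using assms orthogonal_matrix_id
  by (intro conjI allI exI[of _ "mat 1"]) (simp_all add: transpose_mat)

lemma strain_energy_diag_matrix:
  assumes "\<And>i. 0 < l$i" and "l$1 * l$2 * l$3 = 1"
  shows "strain_energy \<mu>1 \<mu>2 (diag_matrix l) = mooney_rivlin \<mu>1 \<mu>2 l"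
  using assms
  by (intro strain_energy_eq_mooney_rivlin singular_values_diag_matrix)
    (auto simp: det_diag_matrix less_imp_le)

text \<open>A case of von Neumann's trace inequality: by cyclicity the trace is the sum of
  \<open>l$i * R$i$i\<close> with \<open>R = transpose Q ** P\<close> orthogonal, whose entries are
  at most 1.\<close>

lemma trace_le_sum_stretches:
  assumes "singular_values F l"
  shows "trace F \<le> l$1 + l$2 + l$3"
proof -
  obtain P Q where PQ: "orthogonal_matrix P" "orthogonal_matrix Q"
    and F: "F = P ** diag_matrix l ** transpose Q"
    using assms unfolding singular_values_def by blast
  have nn: "0 \<le> l$j" for j using assms unfolding singular_values_def by blast
  define R where "R = transpose Q ** P"
  have R: "orthogonal_matrix R"
    using PQ by (simp add: R_def orthogonal_matrix_mul)
  have "R$i$i \<le> 1" for i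
  proof -
    have "norm (R$i) = 1"
      using R by (simp add: orthogonal_matrix_orthonormal_rows row_def)
    then show ?thesis using component_le_norm_cart[of "R$i" i] by simp
  qed
  then have "l$i * R$i$i \<le> l$i" for i
    using mult_left_mono[of "R$i$i" 1 "l$i"] nn by simp
  moreover have "trace F = trace (diag_matrix l ** R)"
    unfolding F R_def by (metis trace_mul_sym matrix_mul_assoc)
  then have "trace F = l$1 * R$1$1 + l$2 * R$2$2 + l$3 * R$3$3"
    by (simp add: trace_3 matrix_matrix_mult_def diag_matrix_def sum_3)
  ultimately show ?thesis by (simp add: add_mono)
qed

text \<open>Only one stretch of \<open>F\<close> has to be controlled, and the characteristic polynomial of
  \<open>transpose F ** F\<close> does so without any perturbation theory for singular values.\<close>

lemma stretch_near:
  assumes "0 < s" "0 < \<eta>" and s: "det (transpose F0 ** F0 - s\<^sup>2 *\<^sub>R mat 1) = 0"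
  obtains \<delta> where "0 < \<delta>"
    and "\<And>F l. norm (F - F0) \<le> \<delta> \<Longrightarrow> singular_values F l \<Longrightarrow> \<exists>i. \<bar>l$i - s\<bar> < \<eta>"
proof -
  let ?f = "\<lambda>F :: real^3^3. det (transpose F ** F - s\<^sup>2 *\<^sub>R mat 1)"
  have "continuous_on UNIV ?f"
    unfolding det_3 matrix_matrix_mult_def transpose_def mat_def
    by simp (intro continuous_intros)
  then have "isCont ?f F0"
    by (simp add: continuous_on_eq_continuous_at)
  \<comment> \<open>If every stretch differed from \<open>s\<close> by at least
    \<open>\<eta>\<close>, each factor \<open>(l$i)\<^sup>2 - s\<^sup>2\<close> of the determinant
    would have modulus at least \<open>\<eta> * s\<close>, because
    \<open>l$i + s \<ge> s\<close>.\<close>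
  moreover have "0 < (\<eta> * s) ^ 3" using assms by simp
  ultimately obtain d where d: "0 < d" "\<And>F. norm (F - F0) < d \<Longrightarrow> \<bar>?f F - ?f F0\<bar> < (\<eta> * s) ^ 3"
    unfolding isCont_def LIM_eq[where f = ?f]
    by (metis diff_self norm_zero abs_zero real_norm_def)
  show ?thesis
  proof (rule that[of "d / 2"])
    fix F l assume F: "norm (F - F0) \<le> d / 2" and l: "singular_values F l"
    show "\<exists>i. \<bar>l$i - s\<bar> < \<eta>"
    proof (rule ccontr)
      assume "\<nexists>i. \<bar>l$i - s\<bar> < \<eta>"
      then have far: "\<eta> \<le> \<bar>l$i - s\<bar>" for i by (auto simp: not_less)
      have "\<eta> * s \<le> \<bar>(l$i)\<^sup>2 - s\<^sup>2\<bar>" for i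
      proof -
        have "0 \<le> l$i" using l unfolding singular_values_def by blast
        then have "\<eta> * s \<le> \<bar>l$i - s\<bar> * \<bar>l$i + s\<bar>"
          using far[of i] assms by (intro mult_mono) auto
        also have "\<dots> = \<bar>(l$i)\<^sup>2 - s\<^sup>2\<bar>"
          by (simp add: abs_mult[symmetric] power2_eq_square algebra_simps)
        finally show ?thesis .
      qed
      then have "\<eta> * s * (\<eta> * s) * (\<eta> * s) \<le>
          \<bar>(l$1)\<^sup>2 - s\<^sup>2\<bar> * \<bar>(l$2)\<^sup>2 - s\<^sup>2\<bar> * \<bar>(l$3)\<^sup>2 - s\<^sup>2\<bar>"
        using assms by (intro mult_mono) auto
      also have "\<dots> = \<bar>?f F - ?f F0\<bar>"
        unfolding s right_stretch_invariants(3)[OF l] by (simp add: abs_mult)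
      finally show False
        using d(2)[of F] F d(1) by (simp add: power3_eq_cube)
    qed
  qed (use d in simp)
qed

section \<open>Stability\<close>

lemma unit_cube_eq_box: "unit_cube = box 0 1"
  by (simp add: unit_cube_def interval_cart)

lemma lmeasurable_unit_cube: "unit_cube \<in> lmeasurable"
  by (simp add: unit_cube_eq_box)

lemma measure_unit_cube: "measure lebesgue unit_cube = 1"
proof -
  have "(1 :: real^3) \<bullet> b = 1" if "b \<in> Basis" for b
    using that by (auto simp: Basis_vec_def inner_axis)
  then have "measure lborel (box 0 (1 :: real^3)) = 1"
    by (simp add: measure_lborel_box_eq)
  then show ?thesis by (simp add: unit_cube_eq_box)
qed

section \<open>Homogeneous deformations and their total energy\<close>

lemma homogeneous_stretch_has_derivative:
  "(homogeneous_stretch l has_derivative (\<lambda>h. diag_matrix l *v h)) (at X)"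
  unfolding homogeneous_stretch_def[abs_def]
  by (rule bounded_linear.has_derivative[OF matrix_vector_mul_bounded_linear has_derivative_ident])

lemma def_grad_homogeneous_stretch: "def_grad (homogeneous_stretch l) X = diag_matrix l"
  using frechet_derivative_at[OF homogeneous_stretch_has_derivative, of l X, symmetric]
  by (simp add: def_grad_def)

lemma isochoric_homogeneous_stretch:
  assumes "l$1 * l$2 * l$3 = 1"
  shows "isochoric_deformation (homogeneous_stretch l)"
proof -
  have d: "homogeneous_stretch l differentiable (at X)" for X
    using homogeneous_stretch_has_derivative by (auto simp: differentiable_def)
  then have "homogeneous_stretch l differentiable_on unit_cube"
    by (simp add: differentiable_at_imp_differentiable_on)
  then have "piecewise_differentiable (homogeneous_stretch l)"
    unfolding piecewise_differentiable_def
    by (intro conjI differentiable_imp_continuous_on exI[of _ "{unit_cube}"])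
      (auto simp: negligible_convex_frontier unit_cube_eq_box)
  then show ?thesis
    by (simp add: isochoric_deformation_def def_grad_homogeneous_stretch det_diag_matrix assms)
qed

lemma total_energy_homogeneous_stretch:
  assumes "\<And>i. 0 < l$i" and "l$1 * l$2 * l$3 = 1"
  shows "total_energy \<mu>1 \<mu>2 \<tau> (homogeneous_stretch l) =
    mooney_rivlin \<mu>1 \<mu>2 l - \<tau> * (l$1 + l$2 + l$3)"
  unfolding total_energy_def def_grad_homogeneous_stretch strain_energy_diag_matrix[OF assms]
    trace_diag_matrix
  using lmeasurable_unit_cube
  by (subst set_integral_const) (auto simp: measure_unit_cube fmeasurable_def)

section \<open>Regularity of competitors and integration of pointwise bounds\<close>

lemma piecewise_differentiable_ae:
  assumes "piecewise_differentiable y"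
  obtains S where "open S" "S \<subseteq> unit_cube" "negligible (unit_cube - S)"
    "\<And>X. X \<in> S \<Longrightarrow> y differentiable (at X)"
proof -
  obtain \<K> where \<K>: "finite \<K>" "\<Union>\<K> = unit_cube"
    and K: "\<And>K. K \<in> \<K> \<Longrightarrow> negligible (frontier K)" "\<And>K. K \<in> \<K> \<Longrightarrow> y differentiable_on K"
    using assms unfolding piecewise_differentiable_def by blast
  show ?thesis
  \<comment> \<open>In the interior of a piece the derivative within the piece is a full derivative;
    the points of the cube left over lie on finitely many negligible frontiers.\<close>
  proof (rule that[of "\<Union>(interior ` \<K>)"])
    show "\<Union>(interior ` \<K>) \<subseteq> unit_cube"
      using \<K>(2) interior_subset by fastforce
    have "negligible (\<Union>(frontier ` \<K>))"
      using \<K>(1) K(1) by (intro negligible_Union) auto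
    moreover have "unit_cube - \<Union>(interior ` \<K>) \<subseteq> \<Union>(frontier ` \<K>)"
    proof
      fix X assume X: "X \<in> unit_cube - \<Union>(interior ` \<K>)"
      then obtain K where "K \<in> \<K>" "X \<in> K" using \<K>(2) by blast
      with X have "X \<in> frontier K" using closure_subset[of K] by (auto simp: frontier_def)
      with \<open>K \<in> \<K>\<close> show "X \<in> \<Union>(frontier ` \<K>)" by blast
    qed
    ultimately show "negligible (unit_cube - \<Union>(interior ` \<K>))"
      by (rule negligible_subset)
    show "y differentiable (at X)" if X: "X \<in> \<Union>(interior ` \<K>)" for X
    proof -
      obtain L where L: "L \<in> \<K>" "X \<in> interior L" using X by blast
      then have "y differentiable (at X within L)"
        using K(2) interior_subset unfolding differentiable_on_def by blast
      then show ?thesis using at_within_interior[OF L(2)] by simp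
    qed
  qed auto
qed

lemma def_grad_measurable:
  assumes S: "open S" and y: "\<And>X. X \<in> S \<Longrightarrow> y differentiable (at X)"
  shows "def_grad y \<in> borel_measurable (lebesgue_on S)"
proof -
  have m: "(\<lambda>X. def_grad y X $ i $ j) \<in> borel_measurable (lebesgue_on S)" for i j
    unfolding def_grad_def
  proof (rule borel_measurable_partial_derivatives)
    show "(y has_derivative frechet_derivative y (at X)) (at X within S)" if "X \<in> S" for X
      using y[OF that] by (simp add: frechet_derivative_works has_derivative_at_withinI)
  qed (use S in auto)
  show ?thesis
    by (subst borel_measurable_euclidean_space) (auto simp: Basis_vec_def inner_axis intro: m)
qed

lemma continuous_polynomial_energy: "continuous_on UNIV (polynomial_energy \<mu>1 \<mu>2)"
  unfolding polynomial_energy_def Let_def trace_def matrix_matrix_mult_def transpose_def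
  by (auto intro!: continuous_intros)

text \<open>A pointwise bound suffices because the energy density of a competitor is integrable;
  otherwise its Lebesgue integral would have the junk value 0.\<close>

lemma total_energy_lower_bound:
  assumes y: "isochoric_deformation y"
    and near: "\<And>X. X \<in> unit_cube \<Longrightarrow> y differentiable (at X) \<Longrightarrow> norm (def_grad y X - F0) \<le> \<delta>"
    and le: "\<And>F. det F = 1 \<Longrightarrow> norm (F - F0) \<le> \<delta> \<Longrightarrow> c \<le> strain_energy \<mu>1 \<mu>2 F - \<tau> * trace F"
  shows "c \<le> total_energy \<mu>1 \<mu>2 \<tau> y"
proof -
  obtain S where S: "open S" "S \<subseteq> unit_cube" "negligible (unit_cube - S)"
    and d: "\<And>X. X \<in> S \<Longrightarrow> y differentiable (at X)"
    using piecewise_differentiable_ae y unfolding isochoric_deformation_def by metis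
  have det: "det (def_grad y X) = 1" if "X \<in> S" for X
    using y d that S(2) unfolding isochoric_deformation_def by blast
  let ?f = "\<lambda>X. strain_energy \<mu>1 \<mu>2 (def_grad y X) - \<tau> * trace (def_grad y X)"
  define \<phi> where "\<phi> F = polynomial_energy \<mu>1 \<mu>2 F - \<tau> * trace F" for F
  have f_eq: "?f X = \<phi> (def_grad y X)" if "X \<in> S" for X
    using strain_energy_eq_polynomial_energy[OF det[OF that]] by (simp add: \<phi>_def)
  have cont: "continuous_on UNIV \<phi>"
    unfolding \<phi>_def[abs_def] trace_def by (intro continuous_intros continuous_polynomial_energy)
  \<comment> \<open>The gradients stay in a compact ball, where the continuous density is bounded;
    with measurability and finite volume this gives integrability.\<close>
  have "bounded (\<phi> ` cball F0 \<delta>)"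
    by (intro compact_imp_bounded compact_continuous_image continuous_on_subset[OF cont]) auto
  then obtain B where B: "\<And>F. F \<in> cball F0 \<delta> \<Longrightarrow> norm (\<phi> F) \<le> B"
    unfolding bounded_iff by blast
  have in_ball: "def_grad y X \<in> cball F0 \<delta>" if "X \<in> S" for X
    using near[of X] d[OF that] that S(2) by (auto simp: dist_norm norm_minus_commute)
  have "S \<in> lmeasurable"
  proof (rule fmeasurableI2[OF lmeasurable_unit_cube S(2)])
    show "S \<in> sets lebesgue" using S(1) by simp
  qed
  have meas: "(\<lambda>X. \<phi> (def_grad y X)) \<in> borel_measurable (lebesgue_on S)"
    using measurable_compose[OF def_grad_measurable[OF S(1) d] borel_measurable_continuous_onI[OF cont]]
    by simp
  have "(\<lambda>X. \<phi> (def_grad y X)) absolutely_integrable_on S"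
  proof (rule measurable_bounded_by_integrable_imp_absolutely_integrable[OF meas])
    show "(\<lambda>X. B) integrable_on S"
      using \<open>S \<in> lmeasurable\<close> by (rule integrable_on_const)
    show "norm (\<phi> (def_grad y X)) \<le> B" if "X \<in> S" for X
      using B in_ball[OF that] .
  qed (use S(1) in simp)
  then have int_S: "?f absolutely_integrable_on S"
    by (rule absolutely_integrable_spike[OF _ negligible_empty]) (use f_eq in simp)
  have spike: "negligible {X \<in> S - unit_cube. g X \<noteq> 0}" "negligible {X \<in> unit_cube - S. g X \<noteq> 0}"
    for g :: "real^3 \<Rightarrow> real"
    using S(2) by (auto intro: negligible_subset[OF S(3)])
  have int_cube: "?f absolutely_integrable_on unit_cube"
    using int_S spike by (rule absolutely_integrable_spike_set)
  have "c = integral unit_cube (\<lambda>X. c)"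
    using lmeasure_integral[OF lmeasurable_unit_cube] integral_mult_right[of unit_cube c "\<lambda>_. 1"]
    by (simp add: measure_unit_cube)
  also have "\<dots> = integral S (\<lambda>X. c)"
    using spike by (intro integral_spike_set)
  also have "\<dots> \<le> integral S ?f"
  proof (rule integral_le)
    show "(\<lambda>X. c) integrable_on S"
      using \<open>S \<in> lmeasurable\<close> by (rule integrable_on_const)
    show "?f integrable_on S" using int_S by (rule set_lebesgue_integral_eq_integral)
    show "c \<le> ?f X" if "X \<in> S" for X
      using le[OF det[OF that]] in_ball[OF that] by (simp add: dist_norm norm_minus_commute)
  qed
  also have "\<dots> = integral unit_cube ?f"
    using spike by (intro integral_spike_set)
  also have "\<dots> = total_energy \<mu>1 \<mu>2 \<tau> y"
    unfolding total_energy_def using set_lebesgue_integral_eq_integral(2)[OF int_cube] by simp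
  finally show ?thesis .
qed

section \<open>From a minimum of the energy density to neutral stability\<close>

lemma neutrally_stable_if_pointwise_minimum:
  assumes l: "\<And>i. 0 < l$i" "l$1 * l$2 * l$3 = 1" and "0 < \<delta>"
    and le: "\<And>F. det F = 1 \<Longrightarrow> norm (F - diag_matrix l) \<le> \<delta> \<Longrightarrow>
      mooney_rivlin \<mu>1 \<mu>2 l - \<tau> * (l$1 + l$2 + l$3) \<le> strain_energy \<mu>1 \<mu>2 F - \<tau> * trace F"
  shows "neutrally_stable \<mu>1 \<mu>2 \<tau> (homogeneous_stretch l)"
  unfolding neutrally_stable_def
proof (intro conjI exI[of _ \<delta>] allI impI isochoric_homogeneous_stretch l \<open>0 < \<delta>\<close>)
  fix y
  assume y: "isochoric_deformation y \<and> (\<forall>X\<in>unit_cube.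
    homogeneous_stretch l differentiable at X \<and> y differentiable at X \<longrightarrow>
    norm (def_grad y X - def_grad (homogeneous_stretch l) X) \<le> \<delta>)"
  show "total_energy \<mu>1 \<mu>2 \<tau> (homogeneous_stretch l) \<le> total_energy \<mu>1 \<mu>2 \<tau> y"
    unfolding total_energy_homogeneous_stretch[OF l]
  proof (rule total_energy_lower_bound[OF _ _ le])
    show "norm (def_grad y X - diag_matrix l) \<le> \<delta>"
      if "X \<in> unit_cube" "y differentiable (at X)" for X
      using y that homogeneous_stretch_has_derivative[of l X]
      by (auto simp: def_grad_homogeneous_stretch differentiable_def)
  qed (use y in auto)
qed

text \<open>Cyclic shifts bring whichever stretch is close to the plate stretch into the first
  position.\<close>

lemma mooney_rivlin_permute:
  "mooney_rivlin \<mu>1 \<mu>2 (vector [l$1, l$2, l$3]) = mooney_rivlin \<mu>1 \<mu>2 l"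
  "mooney_rivlin \<mu>1 \<mu>2 (vector [l$2, l$3, l$1]) = mooney_rivlin \<mu>1 \<mu>2 l"
  "mooney_rivlin \<mu>1 \<mu>2 (vector [l$3, l$1, l$2]) = mooney_rivlin \<mu>1 \<mu>2 l"
  by (simp_all add: mooney_rivlin_def add.commute add.left_commute)

lemma plate_neutrally_stable:
  assumes \<mu>: "0 < \<mu>1" "\<mu>2 < 0" "0 < \<mu>1 + \<mu>2"
    and s: "0 < p" "p < s" "s < q" "q \<le> 1"
    and dec: "\<And>a b. p \<le> a \<Longrightarrow> a < b \<Longrightarrow> b \<le> q \<Longrightarrow> dead_load \<mu>1 \<mu>2 b < dead_load \<mu>1 \<mu>2 a"
    and \<tau>: "\<tau> = dead_load \<mu>1 \<mu>2 s" "0 \<le> \<tau>"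
  shows "neutrally_stable \<mu>1 \<mu>2 \<tau> (homogeneous_stretch (two_equal_stretches s))"
proof -
  have s01: "0 < s" "s < 1" using s by auto
  let ?l = "two_equal_stretches s"
  have l: "0 < ?l$i" for i using s01 exhaust_3[of i] by auto
  have prod: "?l$1 * ?l$2 * ?l$3 = 1" using s01 by simp
  let ?h = "\<lambda>a. 2 / sqrt a * (\<mu>1 + \<mu>2 * a\<^sup>2)"
  have "isCont ?h s" using s01 by (intro continuous_intros) auto
  then have "(?h \<longlongrightarrow> ?h s) (at s)" by (simp only: isCont_def)
  moreover have "\<tau> < ?h s" using dead_load_shear_bound[OF \<mu>(2,1) s01] \<tau> by simp
  ultimately have "\<forall>\<^sub>F a in at s. \<tau> < ?h a" by (rule order_tendstoD)
  moreover have "\<forall>\<^sub>F a in at s. p < a" "\<forall>\<^sub>F a in at s. a < q"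
    using order_tendstoD(1)[OF tendsto_ident_at s(2)] order_tendstoD(2)[OF tendsto_ident_at s(3)]
    by blast+
  ultimately have "\<forall>\<^sub>F a in at s. \<tau> < ?h a \<and> p < a \<and> a < q"
    by eventually_elim simp
  then obtain \<eta> where \<eta>: "0 < \<eta>"
    "\<And>a. a \<noteq> s \<Longrightarrow> \<bar>a - s\<bar> < \<eta> \<Longrightarrow> \<tau> < ?h a \<and> p < a \<and> a < q"
    by (auto simp: eventually_at dist_real_def)
  have near: "\<tau> \<le> ?h a" "p \<le> a" "a \<le> q" if "\<bar>a - s\<bar> < \<eta>" for a
    using \<eta>(2)[of a] that \<open>\<tau> < ?h s\<close> s by (cases "a = s"; force)+
  have energy: "plate_energy \<mu>1 \<mu>2 \<tau> s \<le> mooney_rivlin \<mu>1 \<mu>2 (vector [a, b, c]) - \<tau> * (a + b + c)"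
    if "\<bar>a - s\<bar> < \<eta>" "0 < a" "0 < b" "0 < c" "a * b * c = 1" for a b c
  proof -
    have "plate_energy \<mu>1 \<mu>2 \<tau> s \<le> plate_energy \<mu>1 \<mu>2 \<tau> a"
      unfolding \<tau>(1) using plate_energy_min[OF s(1,4) dec, of s a] near[OF that(1)] s by simp
    also have "\<dots> \<le> mooney_rivlin \<mu>1 \<mu>2 (vector [a, b, c]) - \<tau> * (a + b + c)"
    proof (rule plate_energy_le[OF that(2-) near(1)[OF that(1)]])
      have "a\<^sup>2 \<le> 1" using near[OF that(1)] that(2) s by (simp add: power_le_one)
      then have "\<mu>2 \<le> \<mu>2 * a\<^sup>2" using \<mu>(2) by (simp add: mult_le_cancel_left2)
      then show "0 \<le> \<mu>1 + \<mu>2 * a\<^sup>2" using \<mu>(3) by linarith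
    qed
    finally show ?thesis .
  qed
  have "singular_values (diag_matrix ?l) ?l"
    using l by (intro singular_values_diag_matrix) (simp add: less_imp_le)
  \<comment> \<open>\<open>s\<close> is itself a stretch of the plate, so its square is a root of
    the characteristic polynomial.\<close>
  then have "det (transpose (diag_matrix ?l) ** diag_matrix ?l - s\<^sup>2 *\<^sub>R mat 1) = 0"
    by (simp add: right_stretch_invariants(3))
  then obtain \<delta> where \<delta>: "0 < \<delta>" "\<And>F l. norm (F - diag_matrix ?l) \<le> \<delta> \<Longrightarrow>
      singular_values F l \<Longrightarrow> \<exists>i. \<bar>l$i - s\<bar> < \<eta>"
    using stretch_near[OF s01(1) \<eta>(1)] by metis
  show ?thesis
  proof (rule neutrally_stable_if_pointwise_minimum[OF l prod \<delta>(1)])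
    fix F assume F: "det F = 1" "norm (F - diag_matrix ?l) \<le> \<delta>"
    obtain k where k: "singular_values F k" using singular_values_exist by blast
    note pos = isochoric_stretches(1)[OF k F(1)] and p = isochoric_stretches(2)[OF k F(1)]
    obtain i where i: "\<bar>k$i - s\<bar> < \<eta>" using \<delta>(2)[OF F(2) k] by blast
    have "mooney_rivlin \<mu>1 \<mu>2 ?l - \<tau> * (?l$1 + ?l$2 + ?l$3) = plate_energy \<mu>1 \<mu>2 \<tau> s"
      by (simp add: plate_energy_def)
    also have "\<dots> \<le> mooney_rivlin \<mu>1 \<mu>2 k - \<tau> * (k$1 + k$2 + k$3)"
      using exhaust_3[of i]
    proof (elim disjE)
      assume "i = 1"
      then show ?thesis
        using energy[of "k$1" "k$2" "k$3"] i pos p by (simp add: mooney_rivlin_permute)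
    next
      assume "i = 2"
      then show ?thesis
        using energy[of "k$2" "k$3" "k$1"] i pos p
        by (simp add: mooney_rivlin_permute ac_simps)
    next
      assume "i = 3"
      then show ?thesis
        using energy[of "k$3" "k$1" "k$2"] i pos p
        by (simp add: mooney_rivlin_permute ac_simps)
    qed
    \<comment> \<open>The sign of \<open>\<tau>\<close> enters here: the rotation contained in
      \<open>F\<close> can only lower the trace.\<close>
    also have "\<dots> \<le> strain_energy \<mu>1 \<mu>2 F - \<tau> * trace F"
      using strain_energy_eq_mooney_rivlin[OF k p F(1)]
        mult_left_mono[OF trace_le_sum_stretches[OF k] \<tau>(2)] by simp
    finally show "mooney_rivlin \<mu>1 \<mu>2 ?l - \<tau> * (?l$1 + ?l$2 + ?l$3) \<le>
      strain_energy \<mu>1 \<mu>2 F - \<tau> * trace F" .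
  qed
qed

section \<open>Loss of stability of the reference state\<close>

lemma norm_axis: "norm (axis i x) = norm (x :: 'a :: real_inner)"
  by (simp add: norm_eq_sqrt_inner inner_axis_axis)

text \<open>With \<open>w = r + 1 / r - 2\<close>, which is \<open>(r - 1)\<^sup>2 / r\<close>, the
  energy of \<open>(1, r, 1 / r)\<close> exceeds that of the reference state by
  \<open>w * ((\<mu>1 + \<mu>2) * (w + 4) - 2 * \<tau>) / 2\<close>. As \<open>r\<close> tends to 1
  the bracket tends to \<open>4 * (\<mu>1 + \<mu>2) - 2 * \<tau>\<close>, negative above the
  critical load.\<close>

lemma reference_unstable:
  assumes "2 * (\<mu>1 + \<mu>2) < \<tau>"
  shows "unstable \<mu>1 \<mu>2 \<tau> (homogeneous_stretch reference_stretches)"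
proof -
  let ?ref = "homogeneous_stretch reference_stretches"
  let ?E = "total_energy \<mu>1 \<mu>2 \<tau>"
  have ref: "reference_stretches $ i = 1" for i
    using exhaust_3[of i] by (auto simp: reference_stretches_def)
  have E_ref: "?E ?ref = - 3 * \<tau>"
    by (subst total_energy_homogeneous_stretch) (simp_all add: ref mooney_rivlin_def)
  have "\<not> neutrally_stable \<mu>1 \<mu>2 \<tau> ?ref"
  proof
    assume "neutrally_stable \<mu>1 \<mu>2 \<tau> ?ref"
    then obtain \<delta> where \<delta>: "0 < \<delta>"
      and min: "\<And>y. isochoric_deformation y \<Longrightarrow>
        (\<And>X. X \<in> unit_cube \<Longrightarrow> norm (def_grad y X - def_grad ?ref X) \<le> \<delta>) \<Longrightarrow> ?E ?ref \<le> ?E y"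
      unfolding neutrally_stable_def by blast
    let ?l = "\<lambda>r :: real. vector [1, r, 1 / r] :: real^3"
    let ?D = "\<lambda>r. norm (diag_matrix (?l r) - diag_matrix reference_stretches)"
    let ?h = "\<lambda>r :: real. (\<mu>1 + \<mu>2) * (r + 1 / r + 2)"
    have D: "?D r \<le> \<bar>r - 1\<bar> + \<bar>1 / r - 1\<bar>" for r
    proof -
      have "diag_matrix (?l r) - diag_matrix reference_stretches =
          axis 2 (axis 2 (r - 1)) + axis 3 (axis 3 (1 / r - 1))"
        by (simp add: vec_eq_iff forall_3 diag_matrix_def ref axis_def)
      then show ?thesis
        using norm_triangle_ineq[of "axis 2 (axis 2 (r - 1)) :: real^3^3" "axis 3 (axis 3 (1 / r - 1))"]
        by (simp add: norm_axis)
    qed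
    have "((\<lambda>r. \<bar>r - 1\<bar> + \<bar>1 / r - 1\<bar>) \<longlongrightarrow> \<bar>1 - 1\<bar> + \<bar>1 / 1 - 1\<bar>) (at (1::real))"
      by (intro tendsto_intros) auto
    then have ev1: "\<forall>\<^sub>F r in at 1. \<bar>r - 1\<bar> + \<bar>1 / r - 1\<bar> < \<delta>"
      by (rule order_tendstoD) (use \<delta> in simp)
    have "(?h \<longlongrightarrow> (\<mu>1 + \<mu>2) * (1 + 1 / 1 + 2)) (at 1)"
      by (intro tendsto_intros) auto
    then have ev2: "\<forall>\<^sub>F r in at 1. ?h r < 2 * \<tau>"
      by (rule order_tendstoD) (use assms in simp)
    have ev3: "\<forall>\<^sub>F r in at (1::real). 0 < r"
      by (rule order_tendstoD[OF tendsto_ident_at]) simp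
    have ev4: "\<forall>\<^sub>F r in at (1::real). r \<noteq> 1"
      by (simp add: eventually_at_filter)
    have "\<forall>\<^sub>F r in at (1::real). \<bar>r - 1\<bar> + \<bar>1 / r - 1\<bar> < \<delta> \<and> ?h r < 2 * \<tau> \<and> 0 < r \<and> r \<noteq> 1"
      using ev1 ev2 ev3 ev4 by eventually_elim simp
    then obtain r where r: "\<bar>r - 1\<bar> + \<bar>1 / r - 1\<bar> < \<delta>" "?h r < 2 * \<tau>" "0 < r" "r \<noteq> 1"
      using eventually_happens'[OF trivial_limit_at] by blast
    define w where "w = r + 1 / r - 2"
    have w: "0 < w"
    proof -
      have "w = (r - 1)\<^sup>2 / r" using r(3) by (simp add: w_def field_simps power2_eq_square)
      then show ?thesis using r(3,4) by simp
    qed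
    have l: "0 < ?l r $ i" "?l r $ 1 * ?l r $ 2 * ?l r $ 3 = 1" for i
      using r(3) exhaust_3[of i] by auto
    have "?E (homogeneous_stretch (?l r)) = - 3 * \<tau> + w * ((\<mu>1 + \<mu>2) * (w + 4) - 2 * \<tau>) / 2"
    proof -
      have e: "r\<^sup>2 + 1 / r\<^sup>2 - 2 = w * (w + 4)"
        using r(3) by (simp add: w_def field_simps power2_eq_square)
      have "?E (homogeneous_stretch (?l r)) =
          (\<mu>1 + \<mu>2) / 2 * (r\<^sup>2 + 1 / r\<^sup>2 - 2) - \<tau> * (w + 3)"
        unfolding total_energy_homogeneous_stretch[OF l] mooney_rivlin_def w_def
        by (simp add: power_divide algebra_simps add_divide_distrib)
      also have "\<dots> = - 3 * \<tau> + w * ((\<mu>1 + \<mu>2) * (w + 4) - 2 * \<tau>) / 2"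
        unfolding e by (simp add: field_simps)
      finally show ?thesis .
    qed
    also have "\<dots> < - 3 * \<tau>"
    proof -
      have "(\<mu>1 + \<mu>2) * (w + 4) - 2 * \<tau> < 0"
        using r(2) by (simp add: w_def algebra_simps)
      then have "w * ((\<mu>1 + \<mu>2) * (w + 4) - 2 * \<tau>) < 0" using w by (rule mult_pos_neg[rotated])
      then show ?thesis by simp
    qed
    also have "- 3 * \<tau> \<le> ?E (homogeneous_stretch (?l r))"
      unfolding E_ref[symmetric] using D[of r] r(1) isochoric_homogeneous_stretch[OF l(2)]
      by (intro min) (simp_all add: def_grad_homogeneous_stretch)
    finally show False by simp
  qed
  then show ?thesis
    by (simp add: unstable_def isochoric_homogeneous_stretch ref)
qed

theorem mainTheorem1:
  fixes \<mu>1 \<mu>2 \<mu> :: real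
  assumes "0 < \<mu>1" and "- \<mu>1 / 5 powr (5/3) < \<mu>2" and "\<mu>2 < 0"
    and "\<mu> = \<mu>1 + \<mu>2"
  shows "0 < \<mu>
    \<and> (\<forall>s>0. s \<noteq> 1 \<longrightarrow>
         (baker_ericksen \<mu>1 \<mu>2 (two_equal_stretches s) \<longleftrightarrow> - \<mu>2 / \<mu>1 < s))
    \<and> (\<forall>s \<tau>. - \<mu>2 / \<mu>1 < s \<and> s \<noteq> 1 \<longrightarrow>
         (triaxial_equilibrium \<mu>1 \<mu>2 \<tau> (two_equal_stretches s) \<longleftrightarrow> \<tau> = dead_load \<mu>1 \<mu>2 s))
    \<and> (\<exists>smax smin \<tau>max \<tau>min.
         (local_max_on (dead_load \<mu>1 \<mu>2) {- \<mu>2 / \<mu>1 <..} smax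
          \<and> \<tau>max = dead_load \<mu>1 \<mu>2 smax \<and> 0 < \<tau>max
          \<and> - \<mu>2 / \<mu>1 < smax \<and> smax < - 5 * \<mu>2 / \<mu>1 \<and> - 5 * \<mu>2 / \<mu>1 < 1 / 5 powr (2/3)
          \<and> local_min_on (dead_load \<mu>1 \<mu>2) {- \<mu>2 / \<mu>1 <..} smin
          \<and> \<tau>min = dead_load \<mu>1 \<mu>2 smin \<and> 0 < \<tau>min
          \<and> - 5 * \<mu>2 / \<mu>1 < smin \<and> smin < 1)
       \<and> (\<forall>\<tau>. \<tau>min < \<tau> \<and> \<tau> < \<tau>max \<longrightarrow>
            (\<exists>s. plate_like_equilibrium \<mu>1 \<mu>2 \<tau> s
               \<and> neutrally_stable \<mu>1 \<mu>2 \<tau> (homogeneous_stretch (two_equal_stretches s))))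
       \<and> (2 * \<mu> < \<tau>max \<longrightarrow>
            (\<forall>\<tau>. 2 * \<mu> < \<tau> \<and> \<tau> < \<tau>max \<longrightarrow>
               unstable \<mu>1 \<mu>2 \<tau> (homogeneous_stretch reference_stretches)
               \<and> (\<exists>s. plate_like_equilibrium \<mu>1 \<mu>2 \<tau> s
                    \<and> neutrally_stable \<mu>1 \<mu>2 \<tau> (homogeneous_stretch (two_equal_stretches s)))))
       \<and> ((INF s\<in>{0<..<1}. (s powr (5/2) - 2 * s powr (3/2) + s) / (s powr (3/2) - 1)) < \<mu>2 / \<mu>1
            \<longrightarrow> 2 * \<mu> < \<tau>max))
    \<and> \<bar>(INF s\<in>{0<..<1::real}. (s powr (5/2) - 2 * s powr (3/2) + s) / (s powr (3/2) - 1))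
         - (- 0.045)\<bar> < 0.0005"
proof -
  note \<mu>s = assms(1-3)
  have "1 \<le> (5::real) powr (5/3)" by (simp add: ge_one_powr_ge_zero)
  then have "\<mu>1 / 5 powr (5/3) \<le> \<mu>1" using \<mu>s(1) by (simp add: divide_le_eq)
  then have \<mu>: "0 < \<mu>" using assms(2,4) by simp
  let ?\<tau> = "dead_load \<mu>1 \<mu>2"
  define k where "k = - \<mu>2 / \<mu>1"
  have k: "0 < k" using \<mu>s by (simp add: k_def divide_neg_pos)
  have k5: "- 5 * \<mu>2 / \<mu>1 = 5 * k" by (simp add: k_def)
  have k5_less: "5 * k < 1 / 5 powr (2/3)"
  proof -
    have "k < 1 / 5 powr (5/3)"
      using \<mu>s unfolding k_def by (simp add: field_simps)
    moreover have "(5::real) powr (5/3) = 5 powr (1 + 2/3)" by simp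
    then have "(5::real) powr (5/3) = 5 * 5 powr (2/3)" by (simp only: powr_add) simp
    ultimately show ?thesis by (simp add: field_simps)
  qed
  obtain smax smin where shape: "k < smax" "smax < 5 * k" "5 * k < smin" "smin < 1"
    and inc1: "\<And>a b. 0 < a \<Longrightarrow> a < b \<Longrightarrow> b \<le> smax \<Longrightarrow> ?\<tau> a < ?\<tau> b"
    and dec: "\<And>a b. smax \<le> a \<Longrightarrow> a < b \<Longrightarrow> b \<le> smin \<Longrightarrow> ?\<tau> b < ?\<tau> a"
    and inc2: "\<And>a b. smin \<le> a \<Longrightarrow> a < b \<Longrightarrow> ?\<tau> a < ?\<tau> b"
    using dead_load_shape[OF \<mu>s] unfolding k5 k_def[symmetric] by metis
  have "k < smin" using shape k by linarith
  have pos: "0 < ?\<tau> s" if "k < s" for s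
  proof -
    have "0 < s" using that k by linarith
    moreover have "0 < \<mu>1 + \<mu>2 / s"
      using that \<open>0 < s\<close> \<mu>s(1) by (simp add: k_def field_simps)
    ultimately show ?thesis by (simp add: dead_load_def add_pos_pos)
  qed
  have max_le: "?\<tau> s \<le> ?\<tau> smax" if "0 < s" "s \<le> smin" for s
    using inc1[of s smax] dec[of smax s] that by (cases s smax rule: linorder_cases) auto
  have min_le: "?\<tau> smin \<le> ?\<tau> s" if "smax \<le> s" for s
    using inc2[of smin s] dec[of s smin] that by (cases s smin rule: linorder_cases) auto
  have \<tau>1: "?\<tau> 1 = 2 * \<mu>" using assms(4) by (simp add: dead_load_def)
  have lmax: "local_max_on ?\<tau> {k<..} smax"
    unfolding local_max_on_def
  proof
    have "\<forall>\<^sub>F s in at smax. s < smin"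
      using order_tendstoD(2)[OF tendsto_ident_at, of smax smin UNIV] shape by simp
    then have "\<forall>\<^sub>F s in at smax within {k<..}. s < smin"
      by (rule filter_leD[OF at_le[OF subset_UNIV]])
    moreover have "\<forall>\<^sub>F s in at smax within {k<..}. s \<in> {k<..}"
      by (simp add: eventually_at_filter)
    ultimately show "\<forall>\<^sub>F s in at smax within {k<..}. ?\<tau> s \<le> ?\<tau> smax"
      by eventually_elim (use k max_le in auto)
  qed (use shape in simp)
  have lmin: "local_min_on ?\<tau> {k<..} smin"
    unfolding local_min_on_def
  proof
    have "\<forall>\<^sub>F s in at smin. smax < s"
      using order_tendstoD(1)[OF tendsto_ident_at, of smax smin UNIV] shape by simp
    then have "\<forall>\<^sub>F s in at smin within {k<..}. smax < s"
      by (rule filter_leD[OF at_le[OF subset_UNIV]])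
    then show "\<forall>\<^sub>F s in at smin within {k<..}. ?\<tau> smin \<le> ?\<tau> s"
      by eventually_elim (use min_le in auto)
  qed (use shape k in simp)
  have be: "baker_ericksen \<mu>1 \<mu>2 (two_equal_stretches s) \<longleftrightarrow> k < s" if "0 < s" "s \<noteq> 1" for s
    unfolding k_def using baker_ericksen_two_equal_stretches[OF \<mu>s(1) that] .
  have eq: "triaxial_equilibrium \<mu>1 \<mu>2 \<tau> (two_equal_stretches s) \<longleftrightarrow> \<tau> = ?\<tau> s"
    if "k < s \<and> s \<noteq> 1" for s \<tau>
    using triaxial_equilibrium_two_equal_stretches that k by simp
  have plates: "\<exists>s. plate_like_equilibrium \<mu>1 \<mu>2 \<tau> s
      \<and> neutrally_stable \<mu>1 \<mu>2 \<tau> (homogeneous_stretch (two_equal_stretches s))"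
    if \<tau>: "?\<tau> smin < \<tau> \<and> \<tau> < ?\<tau> smax" for \<tau>
  proof -
    have "continuous_on {smax..smin} ?\<tau>"
      unfolding dead_load_def[abs_def] using shape k by (intro continuous_intros) auto
    then obtain s where "smax \<le> s" "s \<le> smin" and s: "?\<tau> s = \<tau>"
      using IVT2'[of ?\<tau> smin \<tau> smax] \<tau> shape by auto
    then have bounds: "smax < s" "s < smin" using \<tau> by (auto simp: less_le)
    have "neutrally_stable \<mu>1 \<mu>2 \<tau> (homogeneous_stretch (two_equal_stretches s))"
      using \<mu>s \<mu> assms(4) bounds shape k s pos[of s] dec
      by (intro plate_neutrally_stable[of \<mu>1 \<mu>2 smax s smin]) auto
    moreover have "plate_like_equilibrium \<mu>1 \<mu>2 \<tau> s"
      using bounds shape k s be[of s] eq[of s] by (auto simp: plate_like_equilibrium_def)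
    ultimately show ?thesis by blast
  qed
  \<comment> \<open>The load rises from \<open>smin\<close> to 1, where it equals
    \<open>2 * \<mu>\<close>; loads between \<open>2 * \<mu>\<close> and the maximum thus lie in the
    range of the descending branch.\<close>
  have "?\<tau> smin < 2 * \<mu>" using inc2[of smin 1] shape \<tau>1 by simp
  then have post_buckling: "\<exists>s. plate_like_equilibrium \<mu>1 \<mu>2 \<tau> s
      \<and> neutrally_stable \<mu>1 \<mu>2 \<tau> (homogeneous_stretch (two_equal_stretches s))"
    if "2 * \<mu> < \<tau> \<and> \<tau> < ?\<tau> smax" for \<tau>
    using that plates[of \<tau>] by auto
  have unstable: "unstable \<mu>1 \<mu>2 \<tau> (homogeneous_stretch reference_stretches)"
    if "2 * \<mu> < \<tau> \<and> \<tau> < ?\<tau> smax" for \<tau>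
    using that reference_unstable[of \<mu>1 \<mu>2 \<tau>] assms(4) by simp
  have threshold: "2 * \<mu> < ?\<tau> smax"
    if inf: "(INF s\<in>{0<..<1}. (s powr (5/2) - 2 * s powr (3/2) + s) / (s powr (3/2) - 1)) < \<mu>2 / \<mu>1"
  proof -
    obtain s where s: "0 < s" "s < 1"
      and q: "(s powr (5/2) - 2 * s powr (3/2) + s) / (s powr (3/2) - 1) < \<mu>2 / \<mu>1"
      using cInf_lessD[OF _ inf] by auto
    have gt: "2 * \<mu> < ?\<tau> s"
      using dead_load_exceeds_iff[OF \<mu>s(1) s] q assms(4) by simp
    \<comment> \<open>On \<open>{smin..1}\<close> the load is at most its value
      \<open>2 * \<mu>\<close> at 1, so a stretch below 1 with a larger load lies left of the local
      minimum, where \<open>max_le\<close> applies.\<close>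
    then have "s < smin" using inc2[of s 1] s \<tau>1 by (cases "s < smin") auto
    then show ?thesis using gt max_le[of s] s by simp
  qed
  have witnesses: "\<exists>a b c d. P a b c d" if "P smax smin (?\<tau> smax) (?\<tau> smin)"
    for P :: "real \<Rightarrow> real \<Rightarrow> real \<Rightarrow> real \<Rightarrow> bool"
    using that by blast
  show ?thesis
    unfolding k5 k_def[symmetric]
    by (intro conjI witnesses allI impI)
      (assumption | rule refl \<mu> be eq lmax lmin pos shape k5_less \<open>k < smin\<close>
        plates post_buckling unstable threshold infimum_bounds)+
qed

end
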